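(* Let $\mathbf{A}=(A;f_1,\dots,f_\ell)$ be a finite idempotent algebra, and let $m_1\geq m_2\geq\dots\geq m_\ell$ be the arities of the basic operations $f_1,\dots,f_\ell$. Let $N=1+\sum_{i=1}^{r}(m_i-1)$, where $r=\min\left(\ell,\binom{|A|}{2}\right)$. Assume that $N>2$ or $|A|>2$. Then the following are equivalent: (a) $\mathbf{A}$ does not have a cube term (of any dimension). (b) $\mathbf{A}$ has a cube term blocker. (c) $\mathbf{A}$ does not have a cube term of dimension $N$. (d) There is an $N$-ary elusive relation compatible with $\mathbf{A}$. (e) There exists an $N$-ary chipped cube compatible with $\mathbf{A}$.
   Context: Write $[n]=\{1,\dots,n\}$. For $\mathbf{a},\mathbf{b}\in A^n$ and $I\subseteq[n]$, let $\chi_I(\mathbf{a},\mathbf{b})\in A^n$ be the tuple whose $i$-th entry is $b_i$ if $i\in I$ and $a_i$ if $i\notin I$. An algebra is idempotent if $t(a,\dots,a)=a$ for each of its (basic, equivalently term) operations $t$ and each $a\in A$. Term operations are the members of the clone generated by the basic operations. A cube term of dimension $d$ of $\mathbf{A}$ is a $(2^d-1)$-ary term operation $t$ of $\mathbf{A}$, with arguments indexed by the nonempty subsets of $[d]$, such that $t(\chi_I(\mathbf{a},\mathbf{b})\colon \emptyset\neq I\subseteq[d])=\mathbf{a}$ for all $\mathbf{a},\mathbf{b}\in A^d$ ($t$ applied coordinatewise). A relation $R\subseteq A^n$ is compatible with $\mathbf{A}$, written $R\leq\mathbf{A}^n$, if it is a subuniverse of $\mathbf{A}^n$. An $n$-ary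 relation $R$ on $A$ is elusive if there are $\mathbf{a},\mathbf{b}\in A^n$ with $\chi_I(\mathbf{a},\mathbf{b})\in R$ for all nonempty $I\subseteq[n]$ but $\mathbf{a}\notin R$. A cube term blocker of an idempotent algebra $\mathbf{A}$ is a pair $(C,D)$ of nonempty subuniverses of $\mathbf{A}$ with $C\subsetneq D$ such that $D^n\setminus(D\setminus C)^n\leq\mathbf{A}^n$ for every positive integer $n$. An $n$-ary chipped cube is a relation of the form $\left(\prod_{i=1}^{n}D_i\right)\setminus\left(\prod_{i=1}^{n}(D_i\setminus C_i)\right)$ where $\emptyset\neq C_i\subsetneq D_i\subseteq A$ for each $i\in[n]$. *)

theory Defs
  imports Complex_Main "HOL-Library.FuncSet"
begin

text \<open>An n-tuple over \<open>X\<close> is an extensional function on \<open>{1..n}\<close>.\<close>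

abbreviation tuples :: "'a set \<Rightarrow> nat \<Rightarrow> (nat \<Rightarrow> 'a) set" where
  "tuples X n \<equiv> {1..n} \<rightarrow>\<^sub>E X"

text \<open>The basic operations are \<open>oper A 1, \<dots>, oper A (num_opers A)\<close>; the values of \<open>arity\<close> and
  \<open>oper\<close> at other indices carry no meaning.\<close>

record 'a univ_algebra =
  universe :: "'a set"
  num_opers :: nat
  arity :: "nat \<Rightarrow> nat"
  oper :: "nat \<Rightarrow> (nat \<Rightarrow> 'a) \<Rightarrow> 'a"

definition is_algebra :: "'a univ_algebra \<Rightarrow> bool" where
  "is_algebra A \<longleftrightarrow> universe A \<noteq> {} \<and>
     (\<forall>i\<in>{1..num_opers A}. oper A i \<in> tuples (universe A) (arity A i) \<rightarrow>\<^sub>E universe A)"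

definition idempotent_algebra :: "'a univ_algebra \<Rightarrow> bool" where
  "idempotent_algebra A \<longleftrightarrow>
     (\<forall>i\<in>{1..num_opers A}. \<forall>a\<in>universe A. oper A i (\<lambda>k\<in>{1..arity A i}. a) = a)"

definition subuniverse :: "'a univ_algebra \<Rightarrow> 'a set \<Rightarrow> bool" where
  "subuniverse A S \<longleftrightarrow> S \<subseteq> universe A \<and>
     (\<forall>i\<in>{1..num_opers A}. \<forall>x\<in>tuples S (arity A i). oper A i x \<in> S)"

definition power_algebra :: "'a univ_algebra \<Rightarrow> nat \<Rightarrow> (nat \<Rightarrow> 'a) univ_algebra" where
  "power_algebra A n =
     \<lparr>universe = tuples (universe A) n,
      num_opers = num_opers A,
      arity = arity A,
      oper = (\<lambda>i. \<lambda>x\<in>tuples (tuples (universe A) n) (arity A i).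
                \<lambda>j\<in>{1..n}. oper A i (\<lambda>k\<in>{1..arity A i}. x k j))\<rparr>"

definition compatible :: "'a univ_algebra \<Rightarrow> nat \<Rightarrow> (nat \<Rightarrow> 'a) set \<Rightarrow> bool" where
  "compatible A n R \<longleftrightarrow> subuniverse (power_algebra A n) R"

text \<open>\<open>term_operation A n t\<close>: \<open>t\<close> is an n-ary member of the clone generated by the basic
  operations.\<close>

inductive term_operation :: "'a univ_algebra \<Rightarrow> nat \<Rightarrow> ((nat \<Rightarrow> 'a) \<Rightarrow> 'a) \<Rightarrow> bool"
  for A :: "'a univ_algebra" where
  projection:
    "i \<in> {1..n} \<Longrightarrow> term_operation A n (\<lambda>x\<in>tuples (universe A) n. x i)"
| basic:
    "i \<in> {1..num_opers A} \<Longrightarrow> term_operation A (arity A i) (oper A i)"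
| composition:
    "term_operation A k g \<Longrightarrow> (\<And>j. j \<in> {1..k} \<Longrightarrow> term_operation A n (h j)) \<Longrightarrow>
     term_operation A n (\<lambda>x\<in>tuples (universe A) n. g (\<lambda>j\<in>{1..k}. h j x))"

definition chi :: "nat \<Rightarrow> nat set \<Rightarrow> (nat \<Rightarrow> 'a) \<Rightarrow> (nat \<Rightarrow> 'a) \<Rightarrow> nat \<Rightarrow> 'a" where
  "chi n I a b = (\<lambda>i\<in>{1..n}. if i \<in> I then b i else a i)"

text \<open>The bijection \<open>e\<close> indexes the \<open>2 ^ d - 1\<close> arguments of \<open>t\<close> by the nonempty subsets of
  \<open>{1..d}\<close>.\<close>

definition cube_term ::
    "'a univ_algebra \<Rightarrow> nat \<Rightarrow> (nat \<Rightarrow> nat set) \<Rightarrow> ((nat \<Rightarrow> 'a) \<Rightarrow> 'a) \<Rightarrow> bool" where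
  "cube_term A d e t \<longleftrightarrow>
     term_operation A (2 ^ d - 1) t \<and>
     bij_betw e {1..2 ^ d - 1} (Pow {1..d} - {{}}) \<and>
     (\<forall>a\<in>tuples (universe A) d. \<forall>b\<in>tuples (universe A) d.
        (\<lambda>j\<in>{1..d}. t (\<lambda>k\<in>{1..2 ^ d - 1}. chi d (e k) a b j)) = a)"

definition has_cube_term :: "'a univ_algebra \<Rightarrow> nat \<Rightarrow> bool" where
  "has_cube_term A d \<longleftrightarrow> d \<ge> 1 \<and> (\<exists>e t. cube_term A d e t)"

definition elusive :: "'a univ_algebra \<Rightarrow> nat \<Rightarrow> (nat \<Rightarrow> 'a) set \<Rightarrow> bool" where
  "elusive A n R \<longleftrightarrow> R \<subseteq> tuples (universe A) n \<and>
     (\<exists>a\<in>tuples (universe A) n. \<exists>b\<in>tuples (universe A) n.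
        (\<forall>I. I \<noteq> {} \<and> I \<subseteq> {1..n} \<longrightarrow> chi n I a b \<in> R) \<and> a \<notin> R)"

definition cube_term_blocker :: "'a univ_algebra \<Rightarrow> 'a set \<Rightarrow> 'a set \<Rightarrow> bool" where
  "cube_term_blocker A C D \<longleftrightarrow>
     subuniverse A C \<and> subuniverse A D \<and> C \<noteq> {} \<and> D \<noteq> {} \<and> C \<subset> D \<and>
     (\<forall>n\<ge>1. compatible A n (tuples D n - tuples (D - C) n))"

definition chipped_cube :: "'a univ_algebra \<Rightarrow> nat \<Rightarrow> (nat \<Rightarrow> 'a) set \<Rightarrow> bool" where
  "chipped_cube A n R \<longleftrightarrow>
     (\<exists>C D. (\<forall>i\<in>{1..n}. C i \<noteq> {} \<and> C i \<subset> D i \<and> D i \<subseteq> universe A) \<and>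
            R = Pi\<^sub>E {1..n} D - Pi\<^sub>E {1..n} (\<lambda>i. D i - C i))"

end

theory Submission
  imports Defs
begin

text \<open>
  Terms preserve compatible relations, so an elusive compatible relation excludes a cube term of its
  arity. Conversely, being a cube term is a family of conditions, one for each coordinate \<open>i\<close> and each
  pair \<open>(x, y)\<close>. If there is no elusive relation, then any choice of one condition per coordinate is
  satisfied by some term, and by idempotence terms can be amalgamated to satisfy all of them.

  An elusive relation for which the subuniverses \<open>D i\<close> containing \<open>a i\<close> and \<open>b i\<close> are as small as
  possible is, on their product, a chipped cube, and \<open>D i\<close> is generated by any element of \<open>C i\<close>
  together with any element of \<open>D i - C i\<close>. Without a blocker each \<open>(C i, D i)\<close> is killed by an
  operation, that is, for every argument place \<open>k\<close> the operation has a value outside \<open>C i\<close> although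
  its \<open>k\<close>-th argument is in \<open>C i\<close>. An operation of arity \<open>m\<close> kills at most \<open>m - 1\<close> coordinates.
  In a minimal set of operations that kills all coordinates each operation has a private coordinate,
  hence by minimality of the \<open>D i\<close> private two-element subsets of the universe, at least one per
  operation. The only exceptions are two-element \<open>D i\<close> with both singletons as sets \<open>C i\<close>; there
  the operations kill so few coordinates that one of them can be left out of the count.
\<close>

subsection \<open>Counting separated pairs\<close>

lemma choose_two_ge:
  assumes "n \<ge> 3"
  shows "n \<le> n choose 2"
proof -
  have "n * 2 \<le> n * (n - 1)" using assms by (intro mult_le_mono) auto
  from div_le_mono[OF this, of 2] show ?thesis by (simp add: choose_two)
qed

text \<open>For \<open>r > 0\<close> the value \<open>g r\<close> is a threshold: \<open>g\<close>
  is at most \<open>g r\<close> on \<open>J - {1..r}\<close> and at least \<open>g r\<close> on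
  \<open>{1..r} - J\<close>, and the first of these sets is not the larger one.\<close>

lemma sum_antimono_le:
  fixes g :: "nat \<Rightarrow> nat"
  assumes J: "J \<subseteq> {1..l}" "card J \<le> r" "r \<le> l"
    and g: "\<And>i j. 1 \<le> i \<Longrightarrow> i \<le> j \<Longrightarrow> j \<le> l \<Longrightarrow> g j \<le> g i"
  shows "sum g J \<le> sum g {1..r}"
proof -
  let ?S = "{1..r}"
  have fin: "finite J" using J(1) finite_subset by blast
  have "card J = card (J \<inter> ?S) + card (J - ?S)" "card ?S = card (?S \<inter> J) + card (?S - J)"
    using card_Int_Diff[OF fin, of ?S] card_Int_Diff[of ?S J] by auto
  then have card: "card (J - ?S) \<le> card (?S - J)"
    using J(2) by (simp add: Int_commute)
  have "sum g (J - ?S) \<le> card (J - ?S) * g r"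
  proof (cases "r = 0")
    case True
    then have "J = {}" using J(2) fin by simp
    then show ?thesis by simp
  next
    case False
    then have "g j \<le> g r" if "j \<in> J - ?S" for j
      using that J g[of r j] by auto
    then show ?thesis using sum_bounded_above[of "J - ?S" g "g r"] by simp
  qed
  also have "\<dots> \<le> card (?S - J) * g r" using card by simp
  also have "\<dots> \<le> sum g (?S - J)"
    using sum_bounded_below[of "?S - J" "g r" g] g[of _ r] J(3) by simp
  finally have "sum g (J \<inter> ?S) + sum g (J - ?S) \<le> sum g (J \<inter> ?S) + sum g (?S - J)" by simp
  then show ?thesis
    using sum.Int_Diff[OF fin, of g ?S] sum.Int_Diff[of ?S g J] by (simp add: Int_commute)
qed

text \<open>Representatives \<open>\<rho> j\<close> show \<open>card J \<le> card X\<close>. If the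
  inequality is strict, the pairs separated by a single \<open>C j\<close> suffice, since
  \<open>c + e \<le> c * e + 1\<close> for positive \<open>c\<close> and \<open>e\<close>. In case
  of equality the representatives exhaust \<open>X\<close>, so every pair is separated, and a set
  with at least three elements has no fewer pairs than elements.\<close>

lemma card_disjoint_le_card_separated_pairs:
  fixes C :: "'j \<Rightarrow> 'b set"
  assumes X: "finite X" and J: "J \<noteq> {}" and C: "\<And>j. j \<in> J \<Longrightarrow> C j \<noteq> {} \<and> C j \<subset> X"
    and disj: "\<And>i j. i \<in> J \<Longrightarrow> j \<in> J \<Longrightarrow> i \<noteq> j \<Longrightarrow> C i \<inter> C j = {}"
    and two: "\<And>i j. i \<in> J \<Longrightarrow> j \<in> J \<Longrightarrow> i \<noteq> j \<Longrightarrow> card X \<noteq> 2"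
  shows "card J \<le> card {{x, y} | x y j. j \<in> J \<and> x \<in> C j \<and> y \<in> X - C j}" (is "_ \<le> card ?P")
proof -
  have "?P \<subseteq> Pow X" using C by blast
  then have finP: "finite ?P" using X by (meson finite_Pow_iff finite_subset)
  define \<rho> where "\<rho> j = (SOME x. x \<in> C j)" for j
  have \<rho>: "\<rho> j \<in> C j" if "j \<in> J" for j
    using C[OF that] unfolding \<rho>_def by (meson ex_in_conv someI_ex)
  have inj: "inj_on \<rho> J"
  proof (rule inj_onI, rule ccontr)
    fix i j assume ij: "i \<in> J" "j \<in> J" "\<rho> i = \<rho> j" "i \<noteq> j"
    then have "\<rho> i \<in> C i \<inter> C j" using \<rho>[OF ij(1)] \<rho>[OF ij(2)] by simp
    then show False using disj[OF ij(1,2,4)] by simp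
  qed
  have sub: "\<rho> ` J \<subseteq> X" using \<rho> C by blast
  have le: "card J \<le> card X" using card_inj_on_le[OF inj sub X] .
  show ?thesis
  proof (cases "card J = card X")
    case False
    obtain j where j: "j \<in> J" using J by blast
    let ?C = "C j" and ?E = "X - C j"
    have sub: "?C \<subseteq> X" using C[OF j] by blast
    have fin: "finite ?C" "finite ?E" using finite_subset[OF sub X] X by auto
    have card: "card X = card ?C + card ?E"
      using card_Int_Diff[OF X, of ?C] sub by (simp add: Int_absorb1)
    have pos: "0 < card ?C" "0 < card ?E" using C[OF j] fin by (auto simp: card_gt_0_iff)
    have "card X \<le> card ?C * card ?E + 1"
      using pos unfolding card by (cases "card ?C"; cases "card ?E") simp_all
    also have "card ?C * card ?E = card ((\<lambda>(x, y). {x, y}) ` (?C \<times> ?E))"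
    proof (subst card_image)
      show "inj_on (\<lambda>(x, y). {x, y}) (?C \<times> ?E)"
        by (intro inj_onI) (auto simp: doubleton_eq_iff)
    qed (simp add: card_cartesian_product)
    also have "\<dots> \<le> card ?P"
    proof (intro card_mono finP subsetI)
      fix S assume "S \<in> (\<lambda>(x, y). {x, y}) ` (?C \<times> ?E)"
      then obtain x y where "S = {x, y}" "x \<in> ?C" "y \<in> ?E" by auto
      then show "S \<in> ?P" using j by blast
    qed
    finally show ?thesis using le False by simp
  next
    case True
    have surj: "\<rho> ` J = X"
      using card_image[OF inj] True sub X by (intro card_subset_eq) auto
    have "{S. S \<subseteq> X \<and> card S = 2} \<subseteq> ?P"
    proof
      fix S assume "S \<in> {S. S \<subseteq> X \<and> card S = 2}"
      then obtain x y where xy: "S = {x, y}" "x \<noteq> y" "x \<in> X" "y \<in> X"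
        by (auto simp: card_2_iff)
      then obtain i j where "i \<in> J" "j \<in> J" "x = \<rho> i" "y = \<rho> j" using surj by blast
      then have "x \<in> C i" "y \<notin> C i" "i \<in> J" using \<rho> disj xy(2) by blast+
      then show "S \<in> ?P" using xy by blast
    qed
    from card_mono[OF finP this] have "card X choose 2 \<le> card ?P"
      using n_subsets[OF X, of 2] by simp
    \<comment> \<open>The proper subset \<open>C j\<close> misses some \<open>y\<close>, which
      represents another index \<open>i\<close>; for two distinct indices \<open>two\<close>
      excludes a two-element \<open>X\<close>.\<close>
    moreover have "card X \<ge> 3"
    proof -
      obtain j where j: "j \<in> J" using J by blast
      then obtain y where y: "y \<in> X" "y \<notin> C j" using C by blast
      then obtain i where i: "i \<in> J" "y = \<rho> i" using surj by blast
      then have ne: "i \<noteq> j" using y \<rho> by blast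
      moreover have "\<rho> i \<noteq> \<rho> j" using inj i j ne by (auto dest: inj_onD)
      then have "card {\<rho> i, \<rho> j} = 2" by simp
      moreover have "card {\<rho> i, \<rho> j} \<le> card X" using sub i j X by (intro card_mono) auto
      ultimately show ?thesis using two[OF i(1) j] by linarith
    qed
    ultimately show ?thesis using choose_two_ge[of "card X"] True by linarith
  qed
qed

text \<open>By \<open>gen\<close>, a pair separated by \<open>C i\<close> inside \<open>D i\<close>
  determines \<open>D i\<close>. Hence indices with different \<open>D i\<close> separate disjoint
  families of pairs, and the preceding count applies to each class of indices with equal
  \<open>D i\<close>.\<close>

lemma card_separations_le:
  fixes C D :: "'j \<Rightarrow> 'b set"
  assumes V: "finite V" and J: "finite J"
    and CD: "\<And>j. j \<in> J \<Longrightarrow> C j \<noteq> {} \<and> C j \<subset> D j \<and> D j \<subseteq> V"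
    and disj: "\<And>i j. i \<in> J \<Longrightarrow> j \<in> J \<Longrightarrow> i \<noteq> j \<Longrightarrow> D i = D j \<Longrightarrow> C i \<inter> C j = {}"
    and gen: "\<And>i j x y. i \<in> J \<Longrightarrow> j \<in> J \<Longrightarrow> x \<in> C i \<Longrightarrow> y \<in> D i - C i \<Longrightarrow> {x, y} \<subseteq> D j \<Longrightarrow> D i \<subseteq> D j"
    and two: "\<And>i j. i \<in> J \<Longrightarrow> j \<in> J \<Longrightarrow> i \<noteq> j \<Longrightarrow> D i = D j \<Longrightarrow> card (D i) \<noteq> 2"
  shows "card J \<le> card V choose 2"
proof -
  define P where "P X = {{x, y} | x y j. j \<in> {j \<in> J. D j = X} \<and> x \<in> C j \<and> y \<in> X - C j}" for X
  have sub: "P X \<subseteq> {S. S \<subseteq> V \<and> card S = 2}" if "X \<in> D ` J" for X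
  proof
    fix S assume "S \<in> P X"
    then obtain x y j where "S = {x, y}" "j \<in> J" "D j = X" "x \<in> C j" "y \<in> X - C j"
      unfolding P_def by blast
    moreover from this have "x \<noteq> y" "{x, y} \<subseteq> V" using CD[of j] by blast+
    ultimately show "S \<in> {S. S \<subseteq> V \<and> card S = 2}" by simp
  qed
  have finV: "finite {S. S \<subseteq> V \<and> card S = 2}" using V by simp
  have "card J = (\<Sum>X\<in>D ` J. card {j \<in> J. D j = X})"
    using sum.image_gen[OF J, of "\<lambda>_. 1::nat" D] by simp
  also have "\<dots> \<le> (\<Sum>X\<in>D ` J. card (P X))"
  proof (rule sum_mono)
    fix X assume X: "X \<in> D ` J"
    then have "finite X" using CD V finite_subset by blast
    then show "card {j \<in> J. D j = X} \<le> card (P X)"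
      unfolding P_def
    proof (rule card_disjoint_le_card_separated_pairs)
      show "{j \<in> J. D j = X} \<noteq> {}" using X by blast
      show "C j \<noteq> {} \<and> C j \<subset> X" if "j \<in> {j \<in> J. D j = X}" for j
        using CD that by blast
      fix i j assume ij: "i \<in> {j \<in> J. D j = X}" "j \<in> {j \<in> J. D j = X}" "i \<noteq> j"
      then have "D i = D j" by simp
      then show "C i \<inter> C j = {}" "card X \<noteq> 2"
        using disj[of i j] two[of i j] ij by simp_all
    qed
  qed
  also have "\<dots> = card (\<Union>X\<in>D ` J. P X)"
  proof (rule card_UN_disjoint[symmetric])
    show "\<forall>X\<in>D ` J. finite (P X)"
      by (intro ballI finite_subset[OF sub finV])
    have le: "X \<subseteq> Y" if S: "S \<in> P X" "S \<in> P Y" for X Y S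
    proof -
      obtain i x y where "i \<in> J" "D i = X" "x \<in> C i" "y \<in> X - C i" "S = {x, y}"
        using S(1) unfolding P_def by blast
      moreover obtain j u v where "j \<in> J" "D j = Y" "u \<in> C j" "v \<in> Y - C j" "S = {u, v}"
        using S(2) unfolding P_def by blast
      moreover from this have "S \<subseteq> D j" using CD[of j] by blast
      ultimately show ?thesis using gen[of i j x y] by simp
    qed
    show "\<forall>X\<in>D ` J. \<forall>Y\<in>D ` J. X \<noteq> Y \<longrightarrow> P X \<inter> P Y = {}"
    proof (intro ballI impI equals0I)
      fix X Y S assume "X \<noteq> Y" and S: "S \<in> P X \<inter> P Y"
      have "X \<subseteq> Y" by (rule le[of S]) (use S in blast)+
      moreover have "Y \<subseteq> X" by (rule le[of S]) (use S in blast)+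
      ultimately show False using \<open>X \<noteq> Y\<close> by (meson subset_antisym)
    qed
  qed (use J in simp)
  also have "\<dots> \<le> card {S. S \<subseteq> V \<and> card S = 2}"
    by (intro card_mono finV UN_least sub)
  also have "\<dots> = card V choose 2" using n_subsets[OF V] .
  finally show ?thesis .
qed

subsection \<open>Subuniverses and compatible relations\<close>

locale idempotent_alg =
  fixes A :: "'a univ_algebra"
  assumes alg: "is_algebra A" and idem: "idempotent_algebra A"
begin

abbreviation U :: "'a set" where "U \<equiv> universe A"
abbreviation ops :: "nat set" where "ops \<equiv> {1..num_opers A}"

lemma oper_closed:
  assumes "i \<in> ops" "x \<in> tuples U (arity A i)"
  shows "oper A i x \<in> U"
  using alg assms unfolding is_algebra_def by auto

lemma oper_const:
  assumes "i \<in> ops" "a \<in> U"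
  shows "oper A i (\<lambda>k\<in>{1..arity A i}. a) = a"
  using idem assms unfolding idempotent_algebra_def by auto

lemma subuniverseD:
  assumes "subuniverse A S" "i \<in> ops" "\<And>k. k \<in> {1..arity A i} \<Longrightarrow> x k \<in> S"
  shows "oper A i (\<lambda>k\<in>{1..arity A i}. x k) \<in> S"
  using assms unfolding subuniverse_def by (auto simp: restrict_PiE_iff)

lemma subuniverse_subset: "subuniverse A S \<Longrightarrow> S \<subseteq> U"
  by (simp add: subuniverse_def)

lemma subuniverse_Int:
  assumes "subuniverse A S" "subuniverse A T"
  shows "subuniverse A (S \<inter> T)"
proof -
  have "tuples (S \<inter> T) n \<subseteq> tuples S n \<inter> tuples T n" for n
    by (auto simp: PiE_iff)
  then show ?thesis
    using assms unfolding subuniverse_def by blast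
qed

lemma subuniverse_universe: "subuniverse A U"
  unfolding subuniverse_def using oper_closed by auto

lemma compatible_subset: "compatible A n R \<Longrightarrow> R \<subseteq> tuples U n"
  by (simp add: compatible_def subuniverse_def power_algebra_def)

lemma compatibleD:
  assumes "compatible A n R" "i \<in> ops" "\<And>k. k \<in> {1..arity A i} \<Longrightarrow> x k \<in> R"
  shows "(\<lambda>j\<in>{1..n}. oper A i (\<lambda>k\<in>{1..arity A i}. x k j)) \<in> R"
proof -
  let ?x = "restrict x {1..arity A i}"
  have "?x \<in> tuples R (arity A i)" "?x \<in> tuples (tuples U n) (arity A i)"
    using assms(3) compatible_subset[OF assms(1)] by (auto simp only: restrict_PiE_iff)
  moreover have "(\<lambda>k\<in>{1..arity A i}. ?x k j) = (\<lambda>k\<in>{1..arity A i}. x k j)" for j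
    by auto
  moreover have "num_opers (power_algebra A n) = num_opers A" "arity (power_algebra A n) = arity A"
    by (simp_all add: power_algebra_def)
  then have "oper (power_algebra A n) i ?x \<in> R"
    using assms(1,2) \<open>?x \<in> tuples R _\<close> unfolding compatible_def subuniverse_def by metis
  ultimately show ?thesis by (simp only: power_algebra_def univ_algebra.simps restrict_apply if_True)
qed

lemma compatibleI:
  assumes "R \<subseteq> tuples U n"
    and "\<And>i x. i \<in> ops \<Longrightarrow> (\<And>k. k \<in> {1..arity A i} \<Longrightarrow> x k \<in> R) \<Longrightarrow>
           (\<lambda>j\<in>{1..n}. oper A i (\<lambda>k\<in>{1..arity A i}. x k j)) \<in> R"
  shows "compatible A n R"
proof -
  have "oper (power_algebra A n) i x \<in> R"
    if "i \<in> ops" "x \<in> tuples R (arity A i)" for i x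
  proof -
    have "x \<in> tuples (tuples U n) (arity A i)"
      using that(2) assms(1) by (auto simp: PiE_iff)
    moreover have "x k \<in> R" if "k \<in> {1..arity A i}" for k
      using that \<open>x \<in> tuples R _\<close> by auto
    ultimately show ?thesis
      using assms(2)[OF that(1), of x] by (simp add: power_algebra_def)
  qed
  with assms(1) show ?thesis
    by (simp add: compatible_def subuniverse_def power_algebra_def)
qed

lemma compatible_Int_PiE:
  assumes "compatible A n R" "\<And>i. i \<in> {1..n} \<Longrightarrow> subuniverse A (D i)"
  shows "compatible A n (R \<inter> Pi\<^sub>E {1..n} D)"
proof (rule compatibleI)
  show "R \<inter> Pi\<^sub>E {1..n} D \<subseteq> tuples U n"
    using compatible_subset[OF assms(1)] by auto
  fix i x assume i: "i \<in> ops" and x: "\<And>k. k \<in> {1..arity A i} \<Longrightarrow> x k \<in> R \<inter> Pi\<^sub>E {1..n} D"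
  have "oper A i (\<lambda>k\<in>{1..arity A i}. x k j) \<in> D j" if "j \<in> {1..n}" for j
    using x that by (intro subuniverseD[OF assms(2) i]) (auto simp: PiE_iff)
  moreover have "(\<lambda>j\<in>{1..n}. oper A i (\<lambda>k\<in>{1..arity A i}. x k j)) \<in> R"
    using x by (intro compatibleD[OF assms(1) i]) auto
  ultimately show "(\<lambda>j\<in>{1..n}. oper A i (\<lambda>k\<in>{1..arity A i}. x k j)) \<in> R \<inter> Pi\<^sub>E {1..n} D"
    by (auto simp: restrict_PiE_iff)
qed

text \<open>By idempotence, an operation applied to tuples that agree with \<open>z\<close> outside
  \<open>t\<close> returns a tuple that agrees with \<open>z\<close> there.\<close>

lemma slice_subuniverse:
  assumes R: "compatible A n R" and z: "z \<in> tuples U n" and t: "t \<in> {1..n}"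
  shows "subuniverse A {s \<in> U. z(t := s) \<in> R}"
  unfolding subuniverse_def
proof (intro conjI ballI)
  fix i x assume i: "i \<in> ops" and x: "x \<in> tuples {s \<in> U. z(t := s) \<in> R} (arity A i)"
  have xU: "x \<in> tuples U (arity A i)" using x by (auto simp: PiE_iff)
  have "(\<lambda>j\<in>{1..n}. oper A i (\<lambda>k\<in>{1..arity A i}. (z(t := x k)) j)) \<in> R"
    using x compatibleD[OF R i, of "\<lambda>k. z(t := x k)"] by (simp add: PiE_iff)
  also have "(\<lambda>j\<in>{1..n}. oper A i (\<lambda>k\<in>{1..arity A i}. (z(t := x k)) j)) = z(t := oper A i x)"
  proof
    fix j
    have "z j \<in> U" if "j \<in> {1..n}" using z that by auto
    moreover have "(\<lambda>k\<in>{1..arity A i}. x k) = x"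
      using x by (auto simp: PiE_iff extensional_restrict)
    moreover have "z j = undefined" if "j \<notin> {1..n}"
      using z that by (meson PiE_arb)
    ultimately show "(\<lambda>j\<in>{1..n}. oper A i (\<lambda>k\<in>{1..arity A i}. (z(t := x k)) j)) j = (z(t := oper A i x)) j"
      using t oper_const[OF i] by (cases "j = t"; cases "j \<in> {1..n}") auto
  qed
  finally show "oper A i x \<in> {s \<in> U. z(t := s) \<in> R}"
    using oper_closed[OF i xU] by (simp add: fun_upd_def)
qed auto

text \<open>Coordinates are enlarged from \<open>G t\<close> to \<open>D t\<close> one at a time:
  with the other coordinates fixed, the slice of \<open>R\<close> in direction \<open>t\<close> is a
  subuniverse containing \<open>G t\<close>, hence contains all of \<open>D t\<close>.\<close>

lemma box_subset:
  assumes R: "compatible A n R" and "finite T" "T \<subseteq> {1..n}"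
    and G: "\<And>i. i \<in> {1..n} \<Longrightarrow> G i \<subseteq> U"
    and D: "\<And>t. t \<in> T \<Longrightarrow> D t \<subseteq> U"
    and gen: "\<And>t S. t \<in> T \<Longrightarrow> subuniverse A S \<Longrightarrow> G t \<subseteq> S \<Longrightarrow> D t \<subseteq> S"
    and GR: "Pi\<^sub>E {1..n} G \<subseteq> R"
  shows "Pi\<^sub>E {1..n} (\<lambda>i. if i \<in> T then D i else G i) \<subseteq> R"
  using assms(2,3) D gen
proof (induction T)
  case empty
  then show ?case using GR by simp
next
  case (insert t T)
  have IH: "Pi\<^sub>E {1..n} (\<lambda>i. if i \<in> T then D i else G i) \<subseteq> R"
    using insert.prems by (intro insert.IH) blast+
  show ?case
  proof
    fix z assume z: "z \<in> Pi\<^sub>E {1..n} (\<lambda>i. if i \<in> insert t T then D i else G i)"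
    have t: "t \<in> {1..n}" using insert.prems(1) by blast
    have "(if j \<in> insert t T then D j else G j) \<subseteq> U" if "j \<in> {1..n}" for j
      using G[OF that] insert.prems(2)[of j] by presburger
    then have zU: "z \<in> tuples U n"
      using z PiE_mono[of "{1..n}" "\<lambda>j. if j \<in> insert t T then D j else G j" "\<lambda>_. U"] by blast
    have "G t \<subseteq> {s \<in> U. z(t := s) \<in> R}"
    proof
      fix s assume s: "s \<in> G t"
      have "z(t := s) \<in> Pi\<^sub>E {1..n} (\<lambda>i. if i \<in> T then D i else G i)"
        using z s t insert.hyps(2) by (auto simp: PiE_iff extensional_def split: if_splits)
      with IH s G[OF t] show "s \<in> {s \<in> U. z(t := s) \<in> R}" by auto
    qed
    then have "D t \<subseteq> {s \<in> U. z(t := s) \<in> R}"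
      by (intro insert.prems(3) slice_subuniverse[OF R zU t]) auto
    moreover have "z t \<in> D t" using PiE_mem[OF z t] by simp
    ultimately show "z \<in> R" by auto
  qed
qed

section \<open>Term operations and the obstruction to cube terms\<close>

lemma term_preserves:
  assumes "term_operation A m f" "compatible A n R"
    "\<And>k. k \<in> {1..m} \<Longrightarrow> x k \<in> R"
  shows "(\<lambda>j\<in>{1..n}. f (\<lambda>k\<in>{1..m}. x k j)) \<in> R"
  using assms(1,3)
proof (induction arbitrary: x)
  case (projection i m)
  have "x k j \<in> U" if "k \<in> {1..m}" "j \<in> {1..n}" for k j
    using projection(2)[OF that(1)] compatible_subset[OF assms(2)] that by (auto simp: PiE_iff)
  then have "(\<lambda>j\<in>{1..n}. (\<lambda>x\<in>tuples U m. x i) (\<lambda>k\<in>{1..m}. x k j)) = restrict (x i) {1..n}"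
    using projection(1) by (intro restrict_ext) (simp add: restrict_PiE_iff)
  also have "\<dots> = x i"
    using projection compatible_subset[OF assms(2)] by (metis PiE_restrict subsetD)
  finally show ?case using projection by (simp only:)
next
  case (basic i)
  then show ?case by (intro compatibleD[OF assms(2)])
next
  case (composition k g m h)
  have "x l j \<in> U" if "l \<in> {1..m}" "j \<in> {1..n}" for l j
    using composition.prems[OF that(1)] compatible_subset[OF assms(2)] that by (auto simp: PiE_iff)
  then have "(\<lambda>j\<in>{1..n}. (\<lambda>x\<in>tuples U m. g (\<lambda>j\<in>{1..k}. h j x)) (\<lambda>k\<in>{1..m}. x k j))
     = (\<lambda>j\<in>{1..n}. g (\<lambda>l\<in>{1..k}. (\<lambda>j\<in>{1..n}. h l (\<lambda>k\<in>{1..m}. x k j)) j))"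
    by (intro restrict_ext) (simp add: restrict_PiE_iff cong: restrict_cong)
  also have "\<dots> \<in> R"
    by (intro composition.IH(1) composition.IH(2) composition.prems)
  finally show ?case .
qed

text \<open>Applied to the tuples \<open>chi n I a b\<close>, all of which lie in \<open>R\<close>,
  a cube term returns \<open>a\<close>, and terms preserve \<open>R\<close>.\<close>

lemma elusive_no_cube_term:
  assumes "elusive A n R" "compatible A n R"
  shows "\<not> has_cube_term A n"
proof
  assume "has_cube_term A n"
  then obtain e t where t: "term_operation A (2 ^ n - 1) t"
    and e: "bij_betw e {1..2 ^ n - 1} (Pow {1..n} - {{}})"
    and eq: "\<forall>a\<in>tuples U n. \<forall>b\<in>tuples U n.
        (\<lambda>j\<in>{1..n}. t (\<lambda>k\<in>{1..2 ^ n - 1}. chi n (e k) a b j)) = a"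
    unfolding has_cube_term_def cube_term_def by (elim conjE exE)
  from assms(1) obtain a b where ab: "a \<in> tuples U n" "b \<in> tuples U n"
    and R: "\<forall>I. I \<noteq> {} \<and> I \<subseteq> {1..n} \<longrightarrow> chi n I a b \<in> R" and "a \<notin> R"
    unfolding elusive_def by (elim conjE bexE)
  have "chi n (e k) a b \<in> R" if "k \<in> {1..2 ^ n - 1}" for k
    using bij_betwE[OF e] that by (intro R[rule_format]) blast
  from term_preserves[OF t assms(2), of "\<lambda>k. chi n (e k) a b", OF this] have "a \<in> R"
    using eq ab by simp
  with \<open>a \<notin> R\<close> show False ..
qed

text \<open>Take \<open>a i\<close> in \<open>D i - C i\<close> and \<open>b i\<close> in
  \<open>C i\<close>: switching any nonempty set of coordinates to \<open>b\<close> meets some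
  \<open>C i\<close>, while \<open>a\<close> itself meets none.\<close>

lemma chipped_cube_elusive:
  assumes "chipped_cube A n R"
  shows "elusive A n R"
proof -
  from assms obtain C D where "\<forall>i\<in>{1..n}. C i \<noteq> {} \<and> C i \<subset> D i \<and> D i \<subseteq> U"
    and R: "R = Pi\<^sub>E {1..n} D - Pi\<^sub>E {1..n} (\<lambda>i. D i - C i)"
    unfolding chipped_cube_def by (elim conjE exE)
  then have CD: "C i \<noteq> {} \<and> C i \<subset> D i \<and> D i \<subseteq> U" if "i \<in> {1..n}" for i
    using that by blast
  define a where "a = (\<lambda>i\<in>{1..n}. SOME x. x \<in> D i - C i)"
  define b where "b = (\<lambda>i\<in>{1..n}. SOME x. x \<in> C i)"
  have a: "a i \<in> D i - C i" if "i \<in> {1..n}" for i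
    using CD[OF that] that someI_ex[of "\<lambda>x. x \<in> D i - C i"] unfolding a_def by auto
  have b: "b i \<in> C i" if "i \<in> {1..n}" for i
    using CD[OF that] that someI_ex[of "\<lambda>x. x \<in> C i"] unfolding b_def by auto
  have "a \<in> Pi\<^sub>E {1..n} (\<lambda>i. D i - C i)"
    using a unfolding a_def by (simp add: restrict_PiE_iff)
  moreover have "chi n I a b \<in> R" if I: "I \<noteq> {}" "I \<subseteq> {1..n}" for I
  proof -
    have "chi n I a b \<in> Pi\<^sub>E {1..n} D"
      unfolding chi_def restrict_PiE_iff using a b CD by (metis DiffD1 psubsetD)
    moreover obtain i where "i \<in> I" using I by blast
    then have "chi n I a b i \<notin> D i - C i" "i \<in> {1..n}"
      using b I by (auto simp: chi_def)
    ultimately show ?thesis unfolding R by (meson DiffI PiE_mem)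
  qed
  moreover have "R \<subseteq> tuples U n"
    using CD PiE_mono[of "{1..n}" D "\<lambda>_. U"] unfolding R by blast
  moreover have "a \<in> tuples U n" "b \<in> tuples U n"
  proof -
    have "a \<in> extensional {1..n}" "b \<in> extensional {1..n}"
      by (simp_all add: a_def b_def)
    then show "a \<in> tuples U n" "b \<in> tuples U n"
      using a b CD unfolding PiE_iff by blast+
  qed
  ultimately show ?thesis
    unfolding elusive_def R by blast
qed

lemma blocker_chipped_cube:
  assumes "cube_term_blocker A C D" "n \<ge> 1"
  shows "\<exists>R. chipped_cube A n R \<and> compatible A n R"
proof -
  have "compatible A n (tuples D n - tuples (D - C) n)"
    using assms by (simp add: cube_term_blocker_def)
  moreover have "chipped_cube A n (tuples D n - tuples (D - C) n)"
    unfolding chipped_cube_def using assms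
    by (intro exI[of _ "\<lambda>_. C"] exI[of _ "\<lambda>_. D"]) (simp add: cube_term_blocker_def subuniverse_def)
  ultimately show ?thesis by (intro exI[of _ "tuples D n - tuples (D - C) n"] conjI)
qed

subsection \<open>From elusive relations to cube terms\<close>

lemma term_closed:
  assumes "term_operation A n t" "x \<in> tuples U n"
  shows "t x \<in> U"
  using assms
proof (induction arbitrary: x)
  case (basic i)
  then show ?case by (rule oper_closed)
next
  case (composition k g n h)
  then have "(\<lambda>j\<in>{1..k}. h j x) \<in> tuples U k"
    by (simp only: restrict_PiE_iff) blast
  then show ?case using composition by simp
qed auto

lemma term_const:
  assumes "term_operation A n t" "a \<in> U"
  shows "t (\<lambda>k\<in>{1..n}. a) = a"
  using assms
proof induction
  case (basic i)
  then show ?case by (rule oper_const)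
next
  case (composition k g n h)
  then have "(\<lambda>j\<in>{1..k}. h j (\<lambda>k\<in>{1..n}. a)) = (\<lambda>j\<in>{1..k}. a)"
    by (intro restrict_ext) blast
  moreover have "(\<lambda>k\<in>{1..n}. a) \<in> tuples U n"
    using composition.prems by (simp add: restrict_PiE_iff)
  then have "(\<lambda>x\<in>tuples U n. g (\<lambda>j\<in>{1..k}. h j x)) (\<lambda>k\<in>{1..n}. a)
      = g (\<lambda>j\<in>{1..k}. h j (\<lambda>k\<in>{1..n}. a))"
    by (rule restrict_apply')
  ultimately show ?case
    using composition.IH(1)[OF composition.prems] by (simp only:)
qed (simp add: restrict_PiE_iff)

text \<open>The term \<open>u\<close> applies \<open>s\<close> to the arguments \<open>v_I\<close> for \<open>i \<notin> I\<close> and, for \<open>i \<in> I\<close>, to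
  \<open>t (v_{\<sigma> I K})_K\<close>. The index \<open>\<sigma> I K\<close> agrees with \<open>K\<close> at \<open>i\<close> and with \<open>I\<close> elsewhere, except that for
  \<open>I = {i}\<close> it must be \<open>K\<close> itself in order to stay nonempty.\<close>

lemma amalgamate_terms:
  fixes d i :: nat
  assumes e: "bij_betw e {1..M} (Pow {1..d} - {{}})" and i: "i \<in> {1..d}"
    and t: "term_operation A M t" and s: "term_operation A M s"
  defines "row \<equiv> \<lambda>j x y. \<lambda>k\<in>{1..M}. if j \<in> e k then y else x"
  obtains u where "term_operation A M u"
    and "\<And>x y. x \<in> U \<Longrightarrow> y \<in> U \<Longrightarrow> u (row i x y) = s (row i x (t (row i x y)))"
    and "\<And>j x y. j \<noteq> i \<Longrightarrow> x \<in> U \<Longrightarrow> y \<in> U \<Longrightarrow> t (row j x y) = x \<Longrightarrow>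
           u (row j x y) = s (row j x y)"
proof -
  define g where "g = inv_into {1..M} e"
  define \<sigma> where "\<sigma> I K = (if I = {i} then K else (K \<inter> {i}) \<union> (I - {i}))" for I K :: "nat set"
  define p where "p k l = (\<lambda>v\<in>tuples U M. v (g (\<sigma> (e k) (e l))))" for k l
  define h where "h k = (if i \<in> e k then (\<lambda>v\<in>tuples U M. t (\<lambda>l\<in>{1..M}. p k l v))
      else (\<lambda>v\<in>tuples U M. v k))" for k
  define u where "u = (\<lambda>v\<in>tuples U M. s (\<lambda>k\<in>{1..M}. h k v))"
  have ek: "e k \<noteq> {} \<and> e k \<subseteq> {1..d}" if "k \<in> {1..M}" for k
    using bij_betwE[OF e] that by blast
  have g: "g I \<in> {1..M} \<and> e (g I) = I" if "I \<noteq> {}" "I \<subseteq> {1..d}" for I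
  proof -
    have "I \<in> e ` {1..M}" using e that by (auto simp: bij_betw_def)
    then show ?thesis unfolding g_def using inv_into_into[of I e] f_inv_into_f[of I e] by blast
  qed
  have \<sigma>: "\<sigma> (e k) (e l) \<noteq> {} \<and> \<sigma> (e k) (e l) \<subseteq> {1..d}"
    if "k \<in> {1..M}" "l \<in> {1..M}" "i \<in> e k" for k l
    using ek[OF that(1)] ek[OF that(2)] that(3) unfolding \<sigma>_def by auto
  have "term_operation A M (h k)" if k: "k \<in> {1..M}" for k
  proof (cases "i \<in> e k")
    case True
    have "term_operation A M (p k l)" if "l \<in> {1..M}" for l
      unfolding p_def using g \<sigma>[OF k that True] by (intro term_operation.projection) blast
    then show ?thesis using True unfolding h_def
      by (simp only: if_True) (rule term_operation.composition[OF t])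
  next
    case False
    then show ?thesis using k unfolding h_def
      by (simp only: if_False) (rule term_operation.projection)
  qed
  then have u: "term_operation A M u"
    unfolding u_def by (rule term_operation.composition[OF s])
  have row: "row j x y \<in> tuples U M" if "x \<in> U" "y \<in> U" for j x y
    unfolding row_def using that by (simp add: restrict_PiE_iff)
  have p: "p k l (row j x y) = (if j \<in> \<sigma> (e k) (e l) then y else x)"
    if "x \<in> U" "y \<in> U" "k \<in> {1..M}" "l \<in> {1..M}" "i \<in> e k" for j k l x y
    using g[of "\<sigma> (e k) (e l)"] \<sigma>[OF that(3-)] row[OF that(1,2)]
    unfolding p_def by (simp add: row_def)
  show thesis
  proof (rule that[OF u])
    fix x y assume xy: "x \<in> U" "y \<in> U"
    have "h k (row i x y) = row i x (t (row i x y)) k" if k: "k \<in> {1..M}" for k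
    proof (cases "i \<in> e k")
      case True
      \<comment> \<open>The index \<open>\<sigma> I K\<close> agrees with \<open>K\<close> at
        \<open>i\<close>, so the inner \<open>t\<close> sees row \<open>i\<close> unchanged.\<close>
      have "(\<lambda>l\<in>{1..M}. p k l (row i x y)) = row i x y"
        unfolding row_def using p[OF xy k _ True, of _ i] True
        by (intro restrict_ext) (auto simp: row_def \<sigma>_def)
      then show ?thesis using True k row[OF xy] by (simp add: h_def row_def)
    next
      case False
      then show ?thesis using k row[OF xy] by (simp add: h_def row_def)
    qed
    then have "(\<lambda>k\<in>{1..M}. h k (row i x y)) = row i x (t (row i x y))"
      by (auto simp: row_def)
    then show "u (row i x y) = s (row i x (t (row i x y)))"
      using row[OF xy] by (simp add: u_def)
  next
    fix j x y assume j: "j \<noteq> i" and xy: "x \<in> U" "y \<in> U" and tj: "t (row j x y) = x"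
    have "h k (row j x y) = row j x y k" if k: "k \<in> {1..M}" for k
    proof (cases "i \<in> e k")
      case True
      have "t (\<lambda>l\<in>{1..M}. p k l (row j x y)) = row j x y k"
      proof (cases "e k = {i}")
        case eq: True
        \<comment> \<open>For \<open>I = {i}\<close> the inner \<open>t\<close> sees row
          \<open>j\<close> itself and returns \<open>x\<close> by \<open>tj\<close>; this is the
          right entry because \<open>j \<noteq> i\<close>.\<close>
        have "(\<lambda>l\<in>{1..M}. p k l (row j x y)) = row j x y"
          unfolding row_def using p[OF xy k _ True, of _ j] eq
          by (intro restrict_ext) (auto simp: row_def \<sigma>_def)
        then show ?thesis using tj k eq j by (simp add: row_def)
      next
        case False
        \<comment> \<open>Here membership of \<open>j\<close> in \<open>\<sigma> I K\<close> depends
          on \<open>I\<close> only, so the inner \<open>t\<close> has constant arguments and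
          idempotence applies.\<close>
        have "(\<lambda>l\<in>{1..M}. p k l (row j x y)) = (\<lambda>l\<in>{1..M}. if j \<in> e k then y else x)"
          using p[OF xy k _ True, of _ j] j False by (intro restrict_ext) (auto simp: \<sigma>_def)
        then show ?thesis using term_const[OF t, of "if j \<in> e k then y else x"] xy k
          by (simp add: row_def split: if_splits)
      qed
      then show ?thesis using True row[OF xy] by (simp add: h_def)
    next
      case False
      then show ?thesis using k row[OF xy] by (simp add: h_def)
    qed
    then have "(\<lambda>k\<in>{1..M}. h k (row j x y)) = row j x y"
      by (auto simp: row_def)
    then show "u (row j x y) = s (row j x y)"
      using row[OF xy] by (simp add: u_def)
  qed
qed

text \<open>A double induction. In the outer one, the first \<open>m\<close> coordinates satisfy the
  identity for all pairs and the others for one prescribed pair each, with the prescription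
  arbitrary. The inner one adds pairs in a single new coordinate one by one, by means of
  \<open>amalgamate_terms\<close>.\<close>

lemma local_to_global:
  fixes d :: nat
  assumes fin: "finite U" and e: "bij_betw e {1..M} (Pow {1..d} - {{}})"
  defines "row \<equiv> \<lambda>j x y. \<lambda>k\<in>{1..M}. if j \<in> e k then y else x"
  assumes loc: "\<And>a b. (\<And>j. j \<in> {1..d} \<Longrightarrow> a j \<in> U \<and> b j \<in> U) \<Longrightarrow>
      \<exists>t. term_operation A M t \<and> (\<forall>j\<in>{1..d}. t (row j (a j) (b j)) = a j)"
  shows "\<exists>t. term_operation A M t \<and> (\<forall>j\<in>{1..d}. \<forall>x\<in>U. \<forall>y\<in>U. t (row j x y) = x)"
proof -
  have step: "\<exists>t. term_operation A M t \<and>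
      (\<forall>j\<in>{1..d}. if j \<le> m then \<forall>x\<in>U. \<forall>y\<in>U. t (row j x y) = x else t (row j (a j) (b j)) = a j)"
    if "m \<le> d" "\<And>j. j \<in> {1..d} \<Longrightarrow> a j \<in> U \<and> b j \<in> U" for m a b
    using that
  proof (induction m arbitrary: a b)
    case 0
    then show ?case using loc[of a b] by fastforce
  next
    case (Suc m)
    let ?i = "Suc m"
    have i: "?i \<in> {1..d}" using Suc.prems by simp
    have "\<exists>t. term_operation A M t \<and> (\<forall>(x, y)\<in>F. t (row ?i x y) = x) \<and>
        (\<forall>j\<in>{1..d} - {?i}. if j \<le> m then \<forall>x\<in>U. \<forall>y\<in>U. t (row j x y) = x
           else t (row j (a j) (b j)) = a j)"
      if "finite F" "F \<subseteq> U \<times> U" for F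
      using that
    proof (induction F)
      case empty
      then show ?case using Suc.IH[of a b] Suc.prems by force
    next
      case (insert q F)
      obtain x y where q: "q = (x, y)" "x \<in> U" "y \<in> U" using insert.prems by auto
      obtain t where t: "term_operation A M t" "\<forall>(x, y)\<in>F. t (row ?i x y) = x"
        "\<forall>j\<in>{1..d} - {?i}. if j \<le> m then \<forall>x\<in>U. \<forall>y\<in>U. t (row j x y) = x
           else t (row j (a j) (b j)) = a j"
        using insert by auto
      have row: "row ?i x y \<in> tuples U M"
        unfolding row_def using q by (simp add: restrict_PiE_iff)
      \<comment> \<open>The term \<open>t\<close> may fail on the new pair \<open>(x, y)\<close>.
        The term \<open>s\<close> is prescribed the pair \<open>(x, z)\<close> in coordinate
        \<open>?i\<close>, so that it corrects the value \<open>z\<close>.\<close>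
      define z where "z = t (row ?i x y)"
      have z: "z \<in> U" unfolding z_def using term_closed[OF t(1) row] .
      have "\<exists>s. term_operation A M s \<and>
        (\<forall>j\<in>{1..d}. if j \<le> m then \<forall>x\<in>U. \<forall>y\<in>U. s (row j x y) = x
          else s (row j ((a(?i := x)) j) ((b(?i := z)) j)) = (a(?i := x)) j)"
        using Suc.prems q z by (intro Suc.IH) auto
      then obtain s where s: "term_operation A M s"
        and sj: "\<And>j. j \<in> {1..d} \<Longrightarrow> if j \<le> m then \<forall>x\<in>U. \<forall>y\<in>U. s (row j x y) = x
          else s (row j ((a(?i := x)) j) ((b(?i := z)) j)) = (a(?i := x)) j"
        by blast
      have s2: "if j \<le> m then \<forall>x\<in>U. \<forall>y\<in>U. s (row j x y) = x else s (row j (a j) (b j)) = a j"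
        if "j \<in> {1..d} - {?i}" for j
        using sj[of j] that by (auto split: if_splits)
      have s3: "s (row ?i x z) = x" using sj[OF i] by simp
      obtain u where u: "term_operation A M u"
        "\<And>x y. x \<in> U \<Longrightarrow> y \<in> U \<Longrightarrow> u (row ?i x y) = s (row ?i x (t (row ?i x y)))"
        "\<And>j x y. j \<noteq> ?i \<Longrightarrow> x \<in> U \<Longrightarrow> y \<in> U \<Longrightarrow> t (row j x y) = x \<Longrightarrow>
           u (row j x y) = s (row j x y)"
        using amalgamate_terms[OF e i t(1) s] unfolding row_def by blast
      \<comment> \<open>On pairs already in \<open>F\<close> the inner \<open>t\<close> returns
        \<open>x'\<close>, so \<open>s\<close> receives a constant row and the identity
        survives.\<close>
      have "s (row ?i x' x') = x'" if "x' \<in> U" for x'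
        using term_const[OF s that] by (simp add: row_def)
      moreover have "t (row ?i x' y') = x' \<and> x' \<in> U \<and> y' \<in> U" if "(x', y') \<in> F" for x' y'
        using t(2) insert.prems that by blast
      moreover have "u (row ?i x y) = x"
        using u(2)[OF q(2,3)] s3 by (simp only: z_def)
      ultimately have "\<forall>(x, y)\<in>insert q F. u (row ?i x y) = x"
        using u(2) q(1) by fastforce
      moreover have "if j \<le> m then \<forall>x\<in>U. \<forall>y\<in>U. u (row j x y) = x
           else u (row j (a j) (b j)) = a j" if "j \<in> {1..d} - {?i}" for j
        using that t(3) s2[OF that] u(3)[of j] Suc.prems(2)[of j] by auto
      ultimately show ?case using u(1) by blast
    qed
    from this[of "U \<times> U"] fin obtain t where t: "term_operation A M t"
      "\<forall>(x, y)\<in>U \<times> U. t (row ?i x y) = x"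
      "\<forall>j\<in>{1..d} - {?i}. if j \<le> m then \<forall>x\<in>U. \<forall>y\<in>U. t (row j x y) = x
           else t (row j (a j) (b j)) = a j"
      by auto
    have "if j \<le> ?i then \<forall>x\<in>U. \<forall>y\<in>U. t (row j x y) = x else t (row j (a j) (b j)) = a j"
      if "j \<in> {1..d}" for j
      using that t(2) t(3)[rule_format, of j] by (cases "j = ?i") (auto simp: le_Suc_eq)
    with t(1) show ?case by blast
  qed
  \<comment> \<open>For \<open>m = d\<close> no coordinate is left with a prescribed pair, so any
    constant prescription serves.\<close>
  obtain c where "c \<in> U" using alg by (auto simp: is_algebra_def)
  with step[of d "\<lambda>_. c" "\<lambda>_. c"] show ?thesis by auto
qed

text \<open>For one choice of \<open>a\<close> and \<open>b\<close>, the tuples of values of all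
  terms form the compatible relation generated by the tuples \<open>chi d I a b\<close> with
  nonempty \<open>I\<close>. As it is not elusive, it contains \<open>a\<close>, so some term
  satisfies the identities for this choice; \<open>local_to_global\<close> then yields one term for
  all choices.\<close>

lemma cube_term_if_no_elusive:
  assumes fin: "finite U" and d: "d \<ge> 1"
    and none: "\<not> (\<exists>R. elusive A d R \<and> compatible A d R)"
  shows "has_cube_term A d"
proof -
  define M where "M = 2 ^ d - (1::nat)"
  have "card (Pow {1..d} - {{}}) = M"
    by (simp add: card_Diff_singleton card_Pow M_def)
  then obtain e where e: "bij_betw e {1..M} (Pow {1..d} - {{}})"
    using ex_bij_betw_nat_finite_1[of "Pow {1..d} - {{}}"] by auto
  \<comment> \<open>The \<open>j\<close>-th coordinates of all tuples
    \<open>chi d (e k) a b\<close>, when \<open>a j = x\<close> and \<open>b j = y\<close>.\<close>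
  define row where "row j x y = (\<lambda>k\<in>{1..M}. if j \<in> e k then y else x)" for j and x y :: 'a
  have "\<exists>t. term_operation A M t \<and> (\<forall>j\<in>{1..d}. t (row j (a j) (b j)) = a j)"
    if ab: "\<And>j. j \<in> {1..d} \<Longrightarrow> a j \<in> U \<and> b j \<in> U" for a b
  proof -
    define R where "R = {(\<lambda>j\<in>{1..d}. t (row j (a j) (b j))) | t. term_operation A M t}"
    have row: "row j (a j) (b j) \<in> tuples U M" if "j \<in> {1..d}" for j
      unfolding row_def using ab[OF that] by (simp add: restrict_PiE_iff)
    have RU: "R \<subseteq> tuples U d"
      unfolding R_def using term_closed row by (auto simp: restrict_PiE_iff)
    have "compatible A d R"
    proof (rule compatibleI[OF RU])
      fix i x assume i: "i \<in> ops" and "\<And>k. k \<in> {1..arity A i} \<Longrightarrow> x k \<in> R"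
      then have "\<forall>k\<in>{1..arity A i}. \<exists>t. term_operation A M t \<and>
          x k = (\<lambda>j\<in>{1..d}. t (row j (a j) (b j)))"
        unfolding R_def by blast
      then obtain h where h: "\<And>k. k \<in> {1..arity A i} \<Longrightarrow> term_operation A M (h k)"
        "\<And>k. k \<in> {1..arity A i} \<Longrightarrow> x k = (\<lambda>j\<in>{1..d}. h k (row j (a j) (b j)))"
        by metis
      have "term_operation A M (\<lambda>v\<in>tuples U M. oper A i (\<lambda>k\<in>{1..arity A i}. h k v))"
        by (intro term_operation.composition term_operation.basic i h(1))
      moreover have "(\<lambda>j\<in>{1..d}. oper A i (\<lambda>k\<in>{1..arity A i}. x k j)) =
          (\<lambda>j\<in>{1..d}. (\<lambda>v\<in>tuples U M. oper A i (\<lambda>k\<in>{1..arity A i}. h k v)) (row j (a j) (b j)))"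
        using row h(2) by (intro restrict_ext) (simp cong: restrict_cong)
      ultimately show "(\<lambda>j\<in>{1..d}. oper A i (\<lambda>k\<in>{1..arity A i}. x k j)) \<in> R"
        unfolding R_def by blast
    qed
    with none have ne: "\<not> elusive A d R" by blast
    let ?a = "restrict a {1..d}" and ?b = "restrict b {1..d}"
    have tup: "?a \<in> tuples U d" "?b \<in> tuples U d" using ab by (simp_all add: restrict_PiE_iff)
    have "chi d I ?a ?b \<in> R" if I: "I \<noteq> {}" "I \<subseteq> {1..d}" for I
    proof -
      from I e obtain k where k: "k \<in> {1..M}" "e k = I"
        unfolding bij_betw_def by (metis (no_types, lifting) DiffI PowI imageE singletonD)
      have "chi d I ?a ?b = (\<lambda>j\<in>{1..d}. (\<lambda>v\<in>tuples U M. v k) (row j (a j) (b j)))"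
        unfolding chi_def using row k by (intro restrict_ext) (simp add: row_def)
      then show ?thesis unfolding R_def using k term_operation.projection[of k M A] by blast
    qed
    with ne tup RU have "?a \<in> R" unfolding elusive_def by blast
    then obtain t where t: "term_operation A M t" "?a = (\<lambda>j\<in>{1..d}. t (row j (a j) (b j)))"
      unfolding R_def by blast
    have "t (row j (a j) (b j)) = a j" if "j \<in> {1..d}" for j
      using fun_cong[OF t(2), of j] that by simp
    with t(1) show ?thesis by blast
  qed
  from local_to_global[OF fin e, folded row_def, OF this]
  obtain t where t: "term_operation A M t" "\<forall>j\<in>{1..d}. \<forall>x\<in>U. \<forall>y\<in>U. t (row j x y) = x"
    by blast
  have "(\<lambda>j\<in>{1..d}. t (\<lambda>k\<in>{1..M}. chi d (e k) a b j)) = a"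
    if "a \<in> tuples U d" "b \<in> tuples U d" for a b
  proof -
    have "(\<lambda>k\<in>{1..M}. chi d (e k) a b j) = row j (a j) (b j)" if "j \<in> {1..d}" for j
      using that by (simp add: chi_def row_def)
    then have "(\<lambda>j\<in>{1..d}. t (\<lambda>k\<in>{1..M}. chi d (e k) a b j)) = restrict a {1..d}"
      using t(2) that by (intro restrict_ext) (simp add: PiE_iff)
    with that show ?thesis by simp
  qed
  with t(1) e have "cube_term A d e t" unfolding cube_term_def M_def by blast
  with d show ?thesis unfolding has_cube_term_def by blast
qed

subsection \<open>From elusive relations to chipped cubes\<close>

text \<open>Among all boxes of subuniverses that hold a witness \<open>a\<close>, \<open>b\<close>
  of elusiveness, one of least total size is taken. Each \<open>D i\<close> is then generated by
  \<open>a i\<close> and \<open>b i\<close>, for every witness in this box.\<close>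

lemma elusive_imp_minimal_chipped_cube:
  assumes fin: "finite U" and R: "compatible A n R" and el: "elusive A n R"
  obtains C D where "\<And>i. i \<in> {1..n} \<Longrightarrow> subuniverse A (D i)"
    and "\<And>i. i \<in> {1..n} \<Longrightarrow> subuniverse A (C i)"
    and "\<And>i. i \<in> {1..n} \<Longrightarrow> C i \<noteq> {}"
    and "\<And>i. i \<in> {1..n} \<Longrightarrow> C i \<subset> D i"
    and "compatible A n (Pi\<^sub>E {1..n} D - Pi\<^sub>E {1..n} (\<lambda>i. D i - C i))"
    and "\<And>i x c S. i \<in> {1..n} \<Longrightarrow> x \<in> D i - C i \<Longrightarrow> c \<in> C i \<Longrightarrow> subuniverse A S \<Longrightarrow>
           x \<in> S \<Longrightarrow> c \<in> S \<Longrightarrow> D i \<subseteq> S"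
proof -
  define Q where "Q D a b \<longleftrightarrow> (\<forall>i\<in>{1..n}. subuniverse A (D i)) \<and>
      a \<in> Pi\<^sub>E {1..n} D \<and> b \<in> Pi\<^sub>E {1..n} D \<and>
      (\<forall>I. I \<noteq> {} \<and> I \<subseteq> {1..n} \<longrightarrow> chi n I a b \<in> R) \<and> a \<notin> R" for D a b
  define w where "w D = (\<Sum>i\<in>{1..n}. card (D i))" for D :: "nat \<Rightarrow> 'a set"
  obtain a0 b0 where "a0 \<in> tuples U n" "b0 \<in> tuples U n"
      "\<forall>I. I \<noteq> {} \<and> I \<subseteq> {1..n} \<longrightarrow> chi n I a0 b0 \<in> R" "a0 \<notin> R"
    using el unfolding elusive_def by (elim conjE bexE)
  then have "Q (\<lambda>_. U) a0 b0"
    unfolding Q_def using subuniverse_universe by (intro conjI ballI)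
  then have "\<exists>D. (\<exists>a b. Q D a b) \<and> (\<forall>D'. (\<exists>a b. Q D' a b) \<longrightarrow> w D \<le> w D')"
    by (intro ex_has_least_nat[of "\<lambda>D. \<exists>a b. Q D a b"] exI)
  then obtain D a b where Q: "Q D a b" and min: "\<And>D' a' b'. Q D' a' b' \<Longrightarrow> w D \<le> w D'"
    by (elim exE conjE) blast
  have D: "\<And>i. i \<in> {1..n} \<Longrightarrow> subuniverse A (D i)" and a: "a \<in> Pi\<^sub>E {1..n} D"
    and b: "b \<in> Pi\<^sub>E {1..n} D" and aR: "a \<notin> R"
    and chiR: "\<And>I. I \<noteq> {} \<Longrightarrow> I \<subseteq> {1..n} \<Longrightarrow> chi n I a b \<in> R"
    using Q unfolding Q_def by simp_all
  have DU: "D i \<subseteq> U" if "i \<in> {1..n}" for i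
    using subuniverse_subset[OF D[OF that]] .
  have PiU: "x \<in> tuples U n" if "x \<in> Pi\<^sub>E {1..n} D" for x
    using that DU unfolding PiE_iff by blast
  have gen: "D i \<subseteq> S" if "Q D a' b'" "i \<in> {1..n}" "subuniverse A S" "a' i \<in> S" "b' i \<in> S" for a' b' i S
  proof (rule ccontr)
    assume "\<not> D i \<subseteq> S"
    then have "D i \<inter> S \<subset> D i" by blast
    then have less: "card (D i \<inter> S) < card (D i)"
      using finite_subset[OF DU[OF that(2)] fin] psubset_card_mono by blast
    let ?D = "D(i := D i \<inter> S)"
    have "Q ?D a' b'"
      using that D subuniverse_Int[OF D[OF that(2)] that(3)] unfolding Q_def PiE_iff by simp
    then have "w D \<le> w ?D" by (rule min)
    moreover have "w ?D < w D"
      unfolding w_def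
    proof (rule sum_strict_mono_ex1)
      show "\<forall>j\<in>{1..n}. card (?D j) \<le> card (D j)" using less by simp
      show "\<exists>j\<in>{1..n}. card (?D j) < card (D j)"
        using less that(2) by (intro bexI[of _ i]) simp_all
    qed simp
    ultimately show False by simp
  qed
  \<comment> \<open>With coordinate \<open>i\<close> frozen at \<open>x i\<close>, every other
    \<open>D j\<close> is generated by \<open>a j\<close> and \<open>b j\<close>, so membership in
    \<open>R\<close> has to be checked at the vertices only.\<close>
  have box: "x \<in> R" if x: "x \<in> Pi\<^sub>E {1..n} D" and i: "i \<in> {1..n}"
    and z: "\<And>z. z \<in> Pi\<^sub>E {1..n} D \<Longrightarrow> z i = x i \<Longrightarrow> (\<And>j. j \<in> {1..n} \<Longrightarrow> j \<noteq> i \<Longrightarrow> z j = a j \<or> z j = b j) \<Longrightarrow> z \<in> R"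
    for x i
  proof -
    define G where "G j = (if j = i then {x i} else {a j, b j})" for j
    have GD: "G j \<subseteq> D j" if "j \<in> {1..n}" for j
      using PiE_mem[OF x that] PiE_mem[OF a that] PiE_mem[OF b that] by (auto simp: G_def)
    have "Pi\<^sub>E {1..n} (\<lambda>j. if j \<in> {1..n} - {i} then D j else G j) \<subseteq> R"
    proof (rule box_subset[OF R])
      show "G j \<subseteq> U" if "j \<in> {1..n}" for j using GD[OF that] DU[OF that] by blast
      show "D t \<subseteq> U" if "t \<in> {1..n} - {i}" for t using DU that by blast
      show "D t \<subseteq> S" if "t \<in> {1..n} - {i}" "subuniverse A S" "G t \<subseteq> S" for t S
        using that gen[OF Q, of t S] by (simp add: G_def)
      show "Pi\<^sub>E {1..n} G \<subseteq> R"
      proof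
        fix v assume v: "v \<in> Pi\<^sub>E {1..n} G"
        have "v \<in> Pi\<^sub>E {1..n} D" using v GD unfolding PiE_iff by blast
        moreover have "v i = x i" using PiE_mem[OF v i] by (simp add: G_def)
        moreover have "v j = a j \<or> v j = b j" if "j \<in> {1..n}" "j \<noteq> i" for j
          using PiE_mem[OF v that(1)] that(2) by (simp add: G_def)
        ultimately show "v \<in> R" by (rule z)
      qed
    qed auto
    moreover have "x \<in> Pi\<^sub>E {1..n} (\<lambda>j. if j \<in> {1..n} - {i} then D j else G j)"
      using x unfolding PiE_iff G_def by simp
    ultimately show ?thesis by blast
  qed
  \<comment> \<open>The vertices are now tuples \<open>chi n I a b\<close> with
    \<open>i \<in> I\<close>, so \<open>I\<close> is nonempty.\<close>
  have at_b: "x \<in> R" if x: "x \<in> Pi\<^sub>E {1..n} D" and i: "i \<in> {1..n}" and xi: "x i = b i" for x i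
  proof (rule box[OF x i])
    fix z assume z: "z \<in> Pi\<^sub>E {1..n} D" "z i = x i"
      "\<And>j. j \<in> {1..n} \<Longrightarrow> j \<noteq> i \<Longrightarrow> z j = a j \<or> z j = b j"
    let ?I = "{j \<in> {1..n}. z j = b j}"
    have "chi n ?I a b j = z j" for j
    proof (cases "j \<in> {1..n}")
      case True
      then show ?thesis using z(2) z(3)[of j] xi by (cases "j = i") (auto simp: chi_def)
    next
      case False
      then show ?thesis using PiE_arb[OF z(1), of j] by (auto simp: chi_def)
    qed
    then have "chi n ?I a b = z" by blast
    moreover have "i \<in> ?I" using i z(2) xi by simp
    then have "chi n ?I a b \<in> R" by (intro chiR) blast+
    ultimately show "z \<in> R" by simp
  qed
  \<comment> \<open>The slice of \<open>R\<close> through the missing tuple \<open>a\<close> in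
    direction \<open>i\<close>, cut down to \<open>D i\<close>.\<close>
  define C where "C i = {s \<in> U. a(i := s) \<in> R} \<inter> D i" for i
  have upd: "x(i := s) \<in> Pi\<^sub>E {1..n} D" if "x \<in> Pi\<^sub>E {1..n} D" "i \<in> {1..n}" "s \<in> D i" for x i s
    using that by (auto simp: PiE_iff extensional_def)
  have C_sub: "subuniverse A (C i)" if "i \<in> {1..n}" for i
    unfolding C_def using slice_subuniverse[OF R PiU[OF a] that] D[OF that]
    by (rule subuniverse_Int)
  have aC: "a i \<notin> C i" for i
    using aR by (simp add: C_def)
  have bC: "b i \<in> C i" if i: "i \<in> {1..n}" for i
  proof -
    have bi: "b i \<in> D i" using b i by blast
    have "a(i := b i) \<in> R"
      by (rule at_b[OF upd[OF a i bi] i]) simp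
    then show ?thesis using bi DU[OF i] by (auto simp: C_def)
  qed
  \<comment> \<open>A vertex that shares a coordinate with \<open>b\<close> is in \<open>R\<close>
    by \<open>at_b\<close>; the only other vertex is \<open>a(i := x i)\<close>, which is in
    \<open>R\<close> by the definition of \<open>C i\<close>.\<close>
  have at_C: "x \<in> R" if x: "x \<in> Pi\<^sub>E {1..n} D" and i: "i \<in> {1..n}" and xi: "x i \<in> C i" for x i
  proof (rule box[OF x i])
    fix z assume z: "z \<in> Pi\<^sub>E {1..n} D" "z i = x i"
      "\<And>j. j \<in> {1..n} \<Longrightarrow> j \<noteq> i \<Longrightarrow> z j = a j \<or> z j = b j"
    show "z \<in> R"
    proof (cases "\<exists>j\<in>{1..n}. z j = b j")
      case True
      then show ?thesis using at_b[OF z(1)] by blast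
    next
      case False
      then have "z j = (a(i := x i)) j" for j
        using z(2) z(3)[of j] PiE_arb[OF z(1), of j] PiE_arb[OF a, of j] i
        by (cases "j \<in> {1..n}") auto
      then have "z = a(i := x i)" by blast
      then show ?thesis using xi by (simp add: C_def)
    qed
  qed
  \<comment> \<open>Replacing \<open>a i\<close> by \<open>x\<close> and \<open>b i\<close> by
    \<open>c\<close> gives another witness in the same box, so \<open>gen\<close> applies to
    it.\<close>
  have minimal: "D i \<subseteq> S" if i: "i \<in> {1..n}" and x: "x \<in> D i - C i" and c: "c \<in> C i"
    and S: "subuniverse A S" "x \<in> S" "c \<in> S" for i x c S
  proof (rule gen)
    have cD: "c \<in> D i" using c by (simp add: C_def)
    have "a(i := x) \<notin> R" using x DU[OF i] by (auto simp: C_def)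
    moreover have "chi n I (a(i := x)) (b(i := c)) \<in> R" if I: "I \<noteq> {}" "I \<subseteq> {1..n}" for I
    proof -
      have P: "chi n I (a(i := x)) (b(i := c)) \<in> Pi\<^sub>E {1..n} D"
        using a b x cD unfolding chi_def PiE_iff by auto
      show ?thesis
      proof (cases "i \<in> I")
        case True
        then show ?thesis using c i by (intro at_C[OF P i]) (simp add: chi_def)
      next
        case False
        obtain j where j: "j \<in> I" using I by blast
        then have "j \<in> {1..n}" "j \<noteq> i" using False I by auto
        then show ?thesis using j by (intro at_b[OF P, of j]) (simp_all add: chi_def)
      qed
    qed
    ultimately show "Q D (a(i := x)) (b(i := c))"
      unfolding Q_def using D upd[OF a i, of x] upd[OF b i cD] x by blast
  qed (use i S in simp_all)
  \<comment> \<open>Induction on the number of coordinates where \<open>x\<close> differs from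
    \<open>a\<close>. If \<open>x\<close> avoided every \<open>C i\<close>, its slice in a differing
    direction \<open>i\<close> would contain \<open>x i\<close> and \<open>b i\<close>, hence
    \<open>D i\<close> by \<open>minimal\<close>. Resetting coordinate \<open>i\<close> to
    \<open>a i\<close> would then stay in \<open>R\<close>, against the induction
    hypothesis.\<close>
  have key: "\<exists>i\<in>{1..n}. x i \<in> C i" if "x \<in> R" "x \<in> Pi\<^sub>E {1..n} D" for x
    using that
  proof (induction "card {i \<in> {1..n}. x i \<noteq> a i}" arbitrary: x rule: less_induct)
    case less
    show ?case
    proof (rule ccontr)
      assume no: "\<not> (\<exists>i\<in>{1..n}. x i \<in> C i)"
      have "x \<noteq> a" using less.prems aR by blast
      then obtain i where i: "x i \<noteq> a i" by blast
      then have iN: "i \<in> {1..n}" using PiE_arb[OF less.prems(2)] PiE_arb[OF a] by metis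
      let ?x = "x(i := a i)"
      have "{j \<in> {1..n}. ?x j \<noteq> a j} \<subset> {j \<in> {1..n}. x j \<noteq> a j}"
        using i iN by auto
      then have "card {j \<in> {1..n}. ?x j \<noteq> a j} < card {j \<in> {1..n}. x j \<noteq> a j}"
        by (intro psubset_card_mono) auto
      moreover have xD: "?x \<in> Pi\<^sub>E {1..n} D"
        by (rule upd[OF less.prems(2) iN PiE_mem[OF a iN]])
      moreover have "\<not> (\<exists>j\<in>{1..n}. ?x j \<in> C j)" using no aC by simp
      ultimately have xR: "?x \<notin> R" using less.hyps by blast
      let ?S = "{s \<in> U. ?x(i := s) \<in> R}"
      have xi: "x i \<in> D i - C i" using no less.prems(2) iN by blast
      have "subuniverse A ?S" by (rule slice_subuniverse[OF R PiU[OF xD] iN])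
      moreover have "x i \<in> ?S" using less.prems xi DU[OF iN] by auto
      moreover have "b i \<in> ?S"
        using at_b[OF upd[OF xD iN PiE_mem[OF b iN]] iN] PiE_mem[OF b iN] DU[OF iN] by auto
      ultimately have "D i \<subseteq> ?S" by (rule minimal[OF iN xi bC[OF iN]])
      then have "a i \<in> ?S" using PiE_mem[OF a iN] by blast
      then show False using xR by simp
    qed
  qed
  have "R \<inter> Pi\<^sub>E {1..n} D = Pi\<^sub>E {1..n} D - Pi\<^sub>E {1..n} (\<lambda>i. D i - C i)"
  proof (intro equalityI subsetI)
    fix x assume x: "x \<in> R \<inter> Pi\<^sub>E {1..n} D"
    then obtain i where "i \<in> {1..n}" "x i \<in> C i" using key by blast
    then show "x \<in> Pi\<^sub>E {1..n} D - Pi\<^sub>E {1..n} (\<lambda>i. D i - C i)" using x by blast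
  next
    fix x assume x: "x \<in> Pi\<^sub>E {1..n} D - Pi\<^sub>E {1..n} (\<lambda>i. D i - C i)"
    then obtain i where "i \<in> {1..n}" "x i \<in> C i" unfolding PiE_iff by blast
    then show "x \<in> R \<inter> Pi\<^sub>E {1..n} D" using x at_C by blast
  qed
  then have "compatible A n (Pi\<^sub>E {1..n} D - Pi\<^sub>E {1..n} (\<lambda>i. D i - C i))"
    using compatible_Int_PiE[OF R, of D] D by simp
  moreover have "C i \<subset> D i" if "i \<in> {1..n}" for i
    using aC PiE_mem[OF a that] unfolding C_def by blast
  moreover have "C i \<noteq> {}" if "i \<in> {1..n}" for i
    using bC[OF that] by blast
  ultimately show thesis
    by (intro that[of D C] D C_sub minimal)
qed

end

subsection \<open>From chipped cubes to blockers\<close>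

locale minimal_chipped_cube = idempotent_alg +
  fixes N :: nat and C D :: "nat \<Rightarrow> 'a set"
  assumes D_sub: "i \<in> {1..N} \<Longrightarrow> subuniverse A (D i)"
    and C_sub: "i \<in> {1..N} \<Longrightarrow> subuniverse A (C i)"
    and C_ne: "i \<in> {1..N} \<Longrightarrow> C i \<noteq> {}"
    and C_D: "i \<in> {1..N} \<Longrightarrow> C i \<subset> D i"
    and compat: "compatible A N (Pi\<^sub>E {1..N} D - Pi\<^sub>E {1..N} (\<lambda>i. D i - C i))"
    and minimal: "\<lbrakk>i \<in> {1..N}; x \<in> D i - C i; c \<in> C i; subuniverse A S; x \<in> S; c \<in> S\<rbrakk> \<Longrightarrow> D i \<subseteq> S"
begin

text \<open>The set of places \<open>K\<close> need not be all places with an argument in \<open>C i\<close>, so \<open>escapes j i\<close> is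
  closed under subsets; an operation violates the chipped cube iff its places are covered by sets
  escaping in the individual coordinates.\<close>

definition escapes :: "nat \<Rightarrow> nat \<Rightarrow> nat set \<Rightarrow> bool" where
  "escapes j i K \<longleftrightarrow>
     (\<exists>x\<in>tuples (D i) (arity A j). (\<forall>k\<in>K. x k \<in> C i) \<and> oper A j x \<in> D i - C i)"

definition kills :: "nat \<Rightarrow> nat \<Rightarrow> bool" where
  "kills j i \<longleftrightarrow> (\<forall>k\<in>{1..arity A j}. escapes j i {k})"

definition killed :: "nat \<Rightarrow> nat set" where
  "killed j = {i \<in> {1..N}. kills j i}"

section \<open>Covering argument places by escaping sets\<close>

lemma D_univ: "i \<in> {1..N} \<Longrightarrow> D i \<subseteq> U"
  using D_sub subuniverse_subset by blast

lemma oper_D: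
  assumes "i \<in> {1..N}" "j \<in> ops" "x \<in> tuples (D i) (arity A j)"
  shows "oper A j x \<in> D i"
  using D_sub[OF assms(1)] assms(2,3) unfolding subuniverse_def by blast

lemma kills_cong: "C i = C i' \<Longrightarrow> D i = D i' \<Longrightarrow> kills j i = kills j i'"
  unfolding kills_def escapes_def by simp

lemma escapes_mono: "escapes j i L \<Longrightarrow> K \<subseteq> L \<Longrightarrow> escapes j i K"
  unfolding escapes_def by blast

lemma escapes_empty:
  assumes "i \<in> {1..N}" "j \<in> ops"
  shows "escapes j i {}"
proof -
  obtain a where a: "a \<in> D i - C i" using C_D[OF assms(1)] by blast
  then have "a \<in> U" using D_univ[OF assms(1)] by blast
  have "(\<lambda>k\<in>{1..arity A j}. a) \<in> tuples (D i) (arity A j)"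
    using a by (simp add: restrict_PiE_iff)
  moreover have "oper A j (\<lambda>k\<in>{1..arity A j}. a) \<in> D i - C i"
    using oper_const[OF assms(2) \<open>a \<in> U\<close>] a by (simp only:)
  ultimately show ?thesis unfolding escapes_def by blast
qed

text \<open>The witnesses of escaping are the rows of a matrix. Each column lies in the chipped cube
  because its place is covered, yet the tuple of values avoids every \<open>C i\<close>.\<close>

lemma no_cover:
  assumes j: "j \<in> ops" and esc: "\<And>i. i \<in> {1..N} \<Longrightarrow> escapes j i (K i)"
    and cover: "{1..arity A j} \<subseteq> (\<Union>i\<in>{1..N}. K i)"
  shows False
proof -
  have "\<forall>i\<in>{1..N}. \<exists>x. x \<in> tuples (D i) (arity A j) \<and>
      (\<forall>k\<in>K i. x k \<in> C i) \<and> oper A j x \<in> D i - C i"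
    using esc unfolding escapes_def by blast
  then obtain x where x: "\<forall>i\<in>{1..N}. x i \<in> tuples (D i) (arity A j) \<and>
      (\<forall>k\<in>K i. x i k \<in> C i) \<and> oper A j (x i) \<in> D i - C i"
    by (rule bchoice[THEN exE])
  define y where "y k = (\<lambda>i\<in>{1..N}. x i k)" for k
  have "y k \<in> Pi\<^sub>E {1..N} D - Pi\<^sub>E {1..N} (\<lambda>i. D i - C i)" if k: "k \<in> {1..arity A j}" for k
  proof
    have "x i k \<in> D i" if "i \<in> {1..N}" for i
      using x that k by blast
    then show "y k \<in> Pi\<^sub>E {1..N} D" unfolding y_def by (simp add: restrict_PiE_iff)
    obtain i where i: "i \<in> {1..N}" "k \<in> K i" using cover k by blast
    then have "y k i \<in> C i" using x unfolding y_def by simp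
    then show "y k \<notin> Pi\<^sub>E {1..N} (\<lambda>i. D i - C i)" using i(1) PiE_mem by fastforce
  qed
  from compatibleD[OF compat j, of y, OF this]
  have "(\<lambda>i\<in>{1..N}. oper A j (\<lambda>k\<in>{1..arity A j}. y k i)) \<notin> Pi\<^sub>E {1..N} (\<lambda>i. D i - C i)"
    by blast
  moreover have "oper A j (\<lambda>k\<in>{1..arity A j}. y k i) \<in> D i - C i" if i: "i \<in> {1..N}" for i
  proof -
    have xi: "x i \<in> tuples (D i) (arity A j)" using x i by blast
    have "(\<lambda>k\<in>{1..arity A j}. y k i) = restrict (x i) {1..arity A j}"
      using i by (simp add: y_def)
    also have "\<dots> = x i" using xi by (rule PiE_restrict)
    finally show ?thesis using x i by simp
  qed
  ultimately show False by (simp add: restrict_PiE_iff)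
qed

text \<open>A killed coordinate can absorb any single place. The places left over by the sets
  \<open>K i\<close> are distributed injectively among the coordinates in \<open>I\<close>.\<close>

lemma no_cover_killed:
  assumes j: "j \<in> ops" and I: "I \<subseteq> killed j"
    and esc: "\<And>i. i \<in> {1..N} - I \<Longrightarrow> escapes j i (K i)"
    and card: "card ({1..arity A j} - (\<Union>i\<in>{1..N} - I. K i)) \<le> card I"
  shows False
proof -
  let ?P = "{1..arity A j} - (\<Union>i\<in>{1..N} - I. K i)"
  have IN: "I \<subseteq> {1..N}" and kI: "\<And>i. i \<in> I \<Longrightarrow> kills j i"
    using I unfolding killed_def by blast+
  then have "finite I" using finite_subset by blast
  then obtain \<phi> where \<phi>: "\<phi> ` ?P \<subseteq> I" "inj_on \<phi> ?P"
    using card_le_inj[of ?P I] card by blast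
  define L where "L i = (if i \<in> I then {k \<in> ?P. \<phi> k = i} else K i)" for i
  show False
  proof (rule no_cover[OF j])
    fix i assume i: "i \<in> {1..N}"
    show "escapes j i (L i)"
    proof (cases "i \<in> I \<and> L i \<noteq> {}")
      case True
      moreover from True have "L i = {k \<in> ?P. \<phi> k = i}" by (simp only: L_def if_True)
      ultimately have "{k \<in> ?P. \<phi> k = i} \<noteq> {}" by blast
      then obtain k where k: "k \<in> ?P" "\<phi> k = i" by blast
      then have "L i \<subseteq> {k}" using \<phi>(2) True unfolding L_def by (auto dest: inj_onD)
      moreover have "escapes j i {k}" using kI[of i] True k(1) unfolding kills_def by blast
      ultimately show ?thesis using escapes_mono by blast
    next
      case False
      then consider "i \<in> {1..N} - I" | "L i = {}" using i by blast
      then show ?thesis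
      proof cases
        case 1
        then have "L i = K i" unfolding L_def by simp
        then show ?thesis using esc[OF 1] by simp
      next
        case 2
        then show ?thesis using escapes_empty[OF i j] by simp
      qed
    qed
  next
    show "{1..arity A j} \<subseteq> (\<Union>i\<in>{1..N}. L i)"
    proof
      fix k assume k: "k \<in> {1..arity A j}"
      show "k \<in> (\<Union>i\<in>{1..N}. L i)"
      proof (cases "k \<in> ?P")
        case True
        then have "\<phi> k \<in> I" using \<phi>(1) by blast
        then have "k \<in> L (\<phi> k)" "\<phi> k \<in> {1..N}" using True IN unfolding L_def by auto
        then show ?thesis by blast
      next
        case False
        then obtain i where "i \<in> {1..N} - I" "k \<in> K i" using k by blast
        then show ?thesis unfolding L_def by auto
      qed
    qed
  qed
qed

lemma no_cover_killed_one:
  assumes j: "j \<in> ops" and I: "I \<subseteq> killed j" and i: "i \<in> {1..N} - I" and "escapes j i K"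
    and card: "card ({1..arity A j} - K) \<le> card I"
  shows False
proof (rule no_cover_killed[OF j I])
  show "escapes j i' (if i' = i then K else {})" if "i' \<in> {1..N} - I" for i'
    using assms(4) escapes_empty j that by auto
  have "(\<Union>i'\<in>{1..N} - I. if i' = i then K else {}) = K"
    using i by (auto split: if_splits)
  then show "card ({1..arity A j} - (\<Union>i'\<in>{1..N} - I. if i' = i then K else {})) \<le> card I"
    using card by simp
qed

lemma no_cover_two:
  assumes j: "j \<in> ops" and i: "i \<in> {1..N}" "i' \<in> {1..N}" "i \<noteq> i'"
    and esc: "escapes j i K" "escapes j i' ({1..arity A j} - K)"
  shows False
proof (rule no_cover[OF j])
  let ?L = "\<lambda>l. if l = i then K else if l = i' then {1..arity A j} - K else {}"
  show "escapes j l (?L l)" if "l \<in> {1..N}" for l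
    using esc escapes_empty[OF that j] by auto
  show "{1..arity A j} \<subseteq> (\<Union>l\<in>{1..N}. ?L l)"
  proof
    fix k assume "k \<in> {1..arity A j}"
    then have "k \<in> ?L i \<or> k \<in> ?L i'" using i by auto
    then show "k \<in> (\<Union>l\<in>{1..N}. ?L l)" using i by blast
  qed
qed

text \<open>Otherwise every place would have a killed coordinate to itself, with the empty set
  escaping in all other coordinates.\<close>

lemma card_killed:
  assumes "j \<in> ops"
  shows "card (killed j) < arity A j"
proof (rule ccontr)
  assume "\<not> ?thesis"
  then have "card ({1..arity A j} - (\<Union>i\<in>{1..N} - killed j. {})) \<le> card (killed j)" by simp
  then show False
    by (rule no_cover_killed[OF assms order_refl, rotated]) (use escapes_empty assms in blast)
qed

text \<open>An operation that does not kill \<open>i\<close> has a place \<open>k\<close> where an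
  argument from \<open>C i\<close> forces the value into \<open>C i\<close>, as long as all
  arguments are in \<open>D i\<close>. The tuple at place \<open>k\<close> has an entry in
  \<open>C i\<close>, and there the result has one too.\<close>

lemma blocker_if_not_killed:
  assumes i: "i \<in> {1..N}" and nk: "\<And>j. j \<in> ops \<Longrightarrow> \<not> kills j i"
  shows "cube_term_blocker A (C i) (D i)"
proof -
  have "compatible A n (tuples (D i) n - tuples (D i - C i) n)" for n
  proof (rule compatibleI)
    show "tuples (D i) n - tuples (D i - C i) n \<subseteq> tuples U n"
      using PiE_mono[of "{1..n}" "\<lambda>_. D i" "\<lambda>_. U"] D_univ[OF i] by blast
    fix j x assume j: "j \<in> ops"
      and x: "\<And>k. k \<in> {1..arity A j} \<Longrightarrow> x k \<in> tuples (D i) n - tuples (D i - C i) n"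
    obtain k where k: "k \<in> {1..arity A j}" "\<not> escapes j i {k}"
      using nk[OF j] unfolding kills_def by blast
    have "\<not> (\<forall>l\<in>{1..n}. x k l \<notin> C i)"
      using x[OF k(1)] unfolding PiE_iff by blast
    then obtain l where l: "l \<in> {1..n}" "x k l \<in> C i" by blast
    have row: "(\<lambda>k\<in>{1..arity A j}. x k l') \<in> tuples (D i) (arity A j)" if "l' \<in> {1..n}" for l'
      unfolding restrict_PiE_iff using x that by blast
    have "oper A j (\<lambda>k\<in>{1..arity A j}. x k l) \<notin> D i - C i"
    proof
      assume "oper A j (\<lambda>k\<in>{1..arity A j}. x k l) \<in> D i - C i"
      moreover have "\<forall>k'\<in>{k}. (\<lambda>k\<in>{1..arity A j}. x k l) k' \<in> C i" using k(1) l(2) by simp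
      ultimately have "escapes j i {k}" using row[OF l(1)] unfolding escapes_def by blast
      then show False using k(2) by simp
    qed
    then have "(\<lambda>l\<in>{1..n}. oper A j (\<lambda>k\<in>{1..arity A j}. x k l)) \<notin> tuples (D i - C i) n"
      unfolding restrict_PiE_iff using l(1) by blast
    moreover have "(\<lambda>l\<in>{1..n}. oper A j (\<lambda>k\<in>{1..arity A j}. x k l)) \<in> tuples (D i) n"
      unfolding restrict_PiE_iff using oper_D[OF i j row] by blast
    ultimately show "(\<lambda>l\<in>{1..n}. oper A j (\<lambda>k\<in>{1..arity A j}. x k l))
        \<in> tuples (D i) n - tuples (D i - C i) n" by blast
  qed
  then show ?thesis
    using C_sub[OF i] D_sub[OF i] C_ne[OF i] C_D[OF i] unfolding cube_term_blocker_def by blast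
qed

text \<open>If \<open>b\<close> is in both sets and \<open>c\<close> only in \<open>C l\<close>,
  then \<open>b\<close> and \<open>c\<close> generate \<open>D l'\<close> by \<open>minimal\<close>;
  but both lie in \<open>C l\<close>, a proper subuniverse of \<open>D l = D l'\<close>.\<close>

lemma C_disjoint:
  assumes i: "i \<in> {1..N}" "i' \<in> {1..N}" and D: "D i = D i'" and C: "C i \<noteq> C i'"
  shows "C i \<inter> C i' = {}"
proof (rule equals0I)
  have sub: "C l \<subseteq> C l'" if l: "l \<in> {1..N}" "l' \<in> {1..N}" "D l = D l'" "b \<in> C l \<inter> C l'" for l l' b
  proof
    fix c assume c: "c \<in> C l"
    show "c \<in> C l'"
    proof (rule ccontr)
      assume "c \<notin> C l'"
      then have "c \<in> D l' - C l'" using c C_D[OF l(1)] l(3) by blast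
      then have "D l' \<subseteq> C l" using minimal[OF l(2) _ _ C_sub[OF l(1)]] l(4) c by blast
      then show False using C_D[OF l(1)] l(3) by blast
    qed
  qed
  fix b assume b: "b \<in> C i \<inter> C i'"
  then have "b \<in> C i' \<inter> C i" by blast
  then show False using sub[OF i D b] sub[OF i(2,1) D[symmetric]] C by blast
qed

text \<open>A two-element \<open>D i\<close> can carry two different sets \<open>C i\<close>; the operations involved then
  resemble the join and the meet of a two-element lattice.\<close>

definition lattice_pair :: "nat \<Rightarrow> nat \<Rightarrow> bool" where
  "lattice_pair i i' \<longleftrightarrow> i \<in> {1..N} \<and> i' \<in> {1..N} \<and> D i = D i' \<and> C i \<noteq> C i' \<and> card (D i) = 2"

lemma lattice_pair_sym: "lattice_pair i i' \<Longrightarrow> lattice_pair i' i"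
  unfolding lattice_pair_def by auto

text \<open>Here \<open>D i = {a, b}\<close>, \<open>C i = {a}\<close> and
  \<open>C i' = {b}\<close>. On the tuple that is \<open>a\<close> on \<open>K\<close> and
  \<open>b\<close> elsewhere, the value is \<open>b\<close>, which escapes \<open>C i\<close>, or
  \<open>a\<close>, which escapes \<open>C i'\<close>.\<close>

lemma lattice_pair_escapes:
  assumes L: "lattice_pair i i'" and j: "j \<in> ops" and K: "K \<subseteq> {1..arity A j}"
  shows "escapes j i K \<or> escapes j i' ({1..arity A j} - K)"
proof -
  have i: "i \<in> {1..N}" "i' \<in> {1..N}" and D: "D i = D i'" and C: "C i \<noteq> C i'"
    and two: "card (D i) = 2"
    using L unfolding lattice_pair_def by auto
  obtain a b where a: "a \<in> C i" and b: "b \<in> C i'" using C_ne i by blast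
  have "a \<noteq> b" using C_disjoint[OF i D C] a b by blast
  moreover have sub: "{a, b} \<subseteq> D i" using a b C_D[OF i(1)] C_D[OF i(2)] D by blast
  ultimately have Dab: "D i = {a, b}"
    using two card_subset_eq[of "D i" "{a, b}"] card_ge_0_finite[of "D i"] by simp
  have na: "a \<notin> C i'" and nb: "b \<notin> C i" using C_disjoint[OF i D C] a b by blast+
  define x where "x = (\<lambda>k\<in>{1..arity A j}. if k \<in> K then a else b)"
  have x: "x \<in> tuples (D i) (arity A j)"
    unfolding x_def restrict_PiE_iff using Dab by simp
  then have "oper A j x \<in> {a, b}" using oper_D[OF i(1) j] Dab by blast
  then consider "oper A j x = b" | "oper A j x = a" by blast
  then show ?thesis
  proof cases
    case 1
    have "\<forall>k\<in>K. x k \<in> C i" using a K by (auto simp: x_def)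
    then show ?thesis using x 1 Dab nb unfolding escapes_def by auto
  next
    case 2
    have "\<forall>k\<in>{1..arity A j} - K. x k \<in> C i'" using b by (simp add: x_def)
    then show ?thesis using x 2 Dab D na unfolding escapes_def by auto
  qed
qed

text \<open>A place \<open>k\<close> on which \<open>i'\<close> does not escape lets
  \<open>i\<close> escape on all other places at once. A further killed coordinate could take
  \<open>k\<close>, and the two would cover all places.\<close>

lemma lattice_pair_killed:
  assumes L: "lattice_pair i i'" and j: "j \<in> ops" and ki: "kills j i" and ni: "\<not> kills j i'"
  shows "killed j = {i}" and "\<exists>k\<in>{1..arity A j}. escapes j i ({1..arity A j} - {k})"
proof -
  have i: "i \<in> {1..N}" using L unfolding lattice_pair_def by blast
  obtain k where k: "k \<in> {1..arity A j}" "\<not> escapes j i' {k}"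
    using ni unfolding kills_def by blast
  have "{1..arity A j} - ({1..arity A j} - {k}) = {k}" using k(1) by blast
  then have esc: "escapes j i ({1..arity A j} - {k})"
    using lattice_pair_escapes[OF L j, of "{1..arity A j} - {k}"] k(2) by auto
  then show "\<exists>k\<in>{1..arity A j}. escapes j i ({1..arity A j} - {k})" using k(1) by blast
  have "p = i" if p: "p \<in> killed j" for p
  proof (rule ccontr)
    assume "p \<noteq> i"
    moreover have "p \<in> {1..N}" "kills j p" using p unfolding killed_def by auto
    then have "escapes j p {k}" using k(1) unfolding kills_def by blast
    ultimately show False
      using no_cover_two[OF j \<open>p \<in> {1..N}\<close> i, of "{k}"] esc by blast
  qed
  moreover have "i \<in> killed j" using i ki unfolding killed_def by blast
  ultimately show "killed j = {i}" by blast
qed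

text \<open>For some place \<open>k\<close>, coordinate \<open>i\<close> escapes both on
  \<open>{k}\<close> and on the complement of \<open>{k}\<close>. In a lattice pair without
  \<open>i\<close>, one member escapes on one of these two sets, and with \<open>i\<close> taking
  the other all places would be covered.\<close>

lemma lattice_pair_unique:
  assumes L: "lattice_pair i i'" and j: "j \<in> ops" and ki: "kills j i" and ni: "\<not> kills j i'"
    and L2: "lattice_pair p q"
  shows "i = p \<or> i = q"
proof (rule ccontr)
  assume ne: "\<not> (i = p \<or> i = q)"
  have i: "i \<in> {1..N}" and p: "p \<in> {1..N}" and q: "q \<in> {1..N}"
    using L L2 unfolding lattice_pair_def by blast+
  obtain k where k: "k \<in> {1..arity A j}" and esc: "escapes j i ({1..arity A j} - {k})"
    using lattice_pair_killed(2)[OF L j ki ni] by blast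
  have "escapes j i {k}" using ki k unfolding kills_def by blast
  then have "\<not> escapes j q ({1..arity A j} - {k})"
    using no_cover_two[OF j i q] ne by blast
  then have "escapes j p {k}"
    using lattice_pair_escapes[OF L2 j, of "{k}"] k by blast
  then show False
    using no_cover_two[OF j p i] esc ne by blast
qed

text \<open>The pair improves the bound of \<open>card_killed\<close> by one: either
  \<open>i\<close> takes one place besides those absorbed by killed coordinates, or
  \<open>i'\<close> takes all places but one, which a killed coordinate absorbs.\<close>

lemma lattice_pair_card_killed:
  assumes L: "lattice_pair i i'" and j: "j \<in> ops" and ni: "\<not> kills j i" "\<not> kills j i'"
    and ne: "killed j \<noteq> {}"
  shows "card (killed j) + 2 \<le> arity A j"
proof (rule ccontr)
  assume less: "\<not> ?thesis"
  have i: "i \<in> {1..N} - killed j" "i' \<in> {1..N} - killed j"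
    using L ni unfolding lattice_pair_def killed_def by auto
  have "finite (killed j)" unfolding killed_def by simp
  then have pos: "card (killed j) \<ge> 1" using ne by (simp add: Suc_leI card_gt_0_iff)
  then have m: "1 \<in> {1..arity A j}" using card_killed[OF j] by simp
  then consider "escapes j i {1}" | "escapes j i' ({1..arity A j} - {1})"
    using lattice_pair_escapes[OF L j, of "{1}"] by blast
  then show False
  proof cases
    case 1
    have "card ({1..arity A j} - {1}) \<le> card (killed j)" using m less by simp
    then show ?thesis using no_cover_killed_one[OF j order_refl i(1) 1] by blast
  next
    case 2
    have "{1..arity A j} - ({1..arity A j} - {1}) = {1}" using m by blast
    then have "card ({1..arity A j} - ({1..arity A j} - {1})) \<le> card (killed j)" using pos by simp
    then show ?thesis using no_cover_killed_one[OF j order_refl i(2) 2] by blast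
  qed
qed

section \<open>Counting a smallest killing family of operations\<close>

lemma card_private_ops_le:
  assumes fin: "finite U" and J: "finite J" and \<pi>N: "\<And>j. j \<in> J \<Longrightarrow> \<pi> j \<in> {1..N}"
    and priv: "\<And>j j'. j \<in> J \<Longrightarrow> j' \<in> J \<Longrightarrow> kills j' (\<pi> j) \<longleftrightarrow> j' = j"
    and no_pair: "\<And>j j'. j \<in> J \<Longrightarrow> j' \<in> J \<Longrightarrow> \<not> lattice_pair (\<pi> j) (\<pi> j')"
  shows "card J \<le> card U choose 2"
proof (rule card_separations_le[OF fin J, where C = "C \<circ> \<pi>" and D = "D \<circ> \<pi>"])
  \<comment> \<open>Whether an operation kills a coordinate depends only on \<open>C\<close> and
    \<open>D\<close> there, so private coordinates with equal \<open>D\<close> have different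
    \<open>C\<close>.\<close>
  have C_neq: "C (\<pi> j) \<noteq> C (\<pi> j')"
    if "j \<in> J" "j' \<in> J" "j \<noteq> j'" "D (\<pi> j) = D (\<pi> j')" for j j'
    using kills_cong[of "\<pi> j" "\<pi> j'" j] priv that by auto
  show "(C \<circ> \<pi>) j \<noteq> {} \<and> (C \<circ> \<pi>) j \<subset> (D \<circ> \<pi>) j \<and> (D \<circ> \<pi>) j \<subseteq> U" if "j \<in> J" for j
    using C_ne C_D D_univ \<pi>N[OF that] by simp
  show "(C \<circ> \<pi>) j \<inter> (C \<circ> \<pi>) j' = {}"
    if "j \<in> J" "j' \<in> J" "j \<noteq> j'" "(D \<circ> \<pi>) j = (D \<circ> \<pi>) j'" for j j'
    using C_disjoint[OF \<pi>N \<pi>N] C_neq that by simp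
  show "card ((D \<circ> \<pi>) j) \<noteq> 2"
    if "j \<in> J" "j' \<in> J" "j \<noteq> j'" "(D \<circ> \<pi>) j = (D \<circ> \<pi>) j'" for j j'
    using no_pair[of j j'] \<pi>N C_neq that unfolding lattice_pair_def by auto
  show "(D \<circ> \<pi>) j \<subseteq> (D \<circ> \<pi>) j'"
    if "j \<in> J" "j' \<in> J" "x \<in> (C \<circ> \<pi>) j" "y \<in> (D \<circ> \<pi>) j - (C \<circ> \<pi>) j" "{x, y} \<subseteq> (D \<circ> \<pi>) j'"
    for j j' x y
    using minimal[OF \<pi>N[OF that(1)], of y x "D (\<pi> j')"] D_sub[OF \<pi>N[OF that(2)]] that by simp
qed

lemma dimension_bound:
  assumes fin: "finite U" and N: "N > 2 \<or> card U > 2"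
    and all: "\<And>i. i \<in> {1..N} \<Longrightarrow> \<exists>j\<in>ops. kills j i"
  shows "\<exists>J\<subseteq>ops. card J \<le> card U choose 2 \<and> N \<le> (\<Sum>j\<in>J. arity A j - 1)"
proof -
  let ?covers = "\<lambda>J. J \<subseteq> ops \<and> (\<forall>i\<in>{1..N}. \<exists>j\<in>J. kills j i)"
  have "?covers ops" using all by blast
  then obtain J where J: "?covers J" and least: "\<forall>J'. ?covers J' \<longrightarrow> card J \<le> card J'"
    using ex_has_least_nat[of ?covers ops card] by (elim exE conjE) blast
  have finJ: "finite J" using J finite_subset by blast
  have "\<exists>i\<in>{1..N}. \<forall>j'\<in>J. kills j' i \<longleftrightarrow> j' = j" if j: "j \<in> J" for j
  proof -
    have "card (J - {j}) < card J" using finJ j by (rule card_Diff1_less)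
    then have "\<not> ?covers (J - {j})" using least leD by blast
    then obtain i where i: "i \<in> {1..N}" "\<forall>j'\<in>J - {j}. \<not> kills j' i" using J by blast
    then have "\<forall>j'\<in>J. kills j' i \<longleftrightarrow> j' = j" using J by blast
    then show ?thesis using i(1) by blast
  qed
  then have "\<forall>j\<in>J. \<exists>i. i \<in> {1..N} \<and> (\<forall>j'\<in>J. kills j' i \<longleftrightarrow> j' = j)" by blast
  then obtain \<pi> where "\<forall>j\<in>J. \<pi> j \<in> {1..N} \<and> (\<forall>j'\<in>J. kills j' (\<pi> j) \<longleftrightarrow> j' = j)"
    by (rule bchoice[THEN exE])
  then have \<pi>N: "\<And>j. j \<in> J \<Longrightarrow> \<pi> j \<in> {1..N}"
    and priv: "\<And>j j'. j \<in> J \<Longrightarrow> j' \<in> J \<Longrightarrow> kills j' (\<pi> j) \<longleftrightarrow> j' = j"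
    by blast+
  have ops: "j \<in> ops" if "j \<in> J" for j using J that by blast
  have \<pi>_inj: "\<pi> j \<noteq> \<pi> j'" if "j \<in> J" "j' \<in> J" "j \<noteq> j'" for j j'
    using priv that by metis
  have ne: "killed j \<noteq> {}" if "j \<in> J" for j
    using priv[OF that that] \<pi>N[OF that] unfolding killed_def by blast
  have "{1..N} = (\<Union>j\<in>J. killed j)" using J unfolding killed_def by blast
  then have sum: "N \<le> (\<Sum>j\<in>J. card (killed j))"
    using card_UN_le[OF finJ, of killed] card_atLeastAtMost[of 1 N] by simp
  have le: "card (killed j) \<le> arity A j - 1" if "j \<in> J" for j
    using card_killed[OF ops[OF that]] by simp
  then have "(\<Sum>j\<in>J. card (killed j)) \<le> (\<Sum>j\<in>J. arity A j - 1)"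
    by (rule sum_mono)
  with sum have sum_le: "N \<le> (\<Sum>j\<in>J. arity A j - 1)" by (rule le_trans)
  show ?thesis
  proof (cases "\<exists>j\<in>J. \<exists>j'\<in>J. lattice_pair (\<pi> j) (\<pi> j')")
    case False
    have "card J \<le> card U choose 2"
      by (rule card_private_ops_le[OF fin finJ \<pi>N priv]) (use False in blast)+
    then show ?thesis using J sum_le by (intro exI[of _ J] conjI) simp_all
  next
    case True
    then obtain j1 j2 where j: "j1 \<in> J" "j2 \<in> J" and L: "lattice_pair (\<pi> j1) (\<pi> j2)" by blast
    have neq: "j1 \<noteq> j2" using L unfolding lattice_pair_def by auto
    have k1: "kills j1 (\<pi> j1)" "\<not> kills j1 (\<pi> j2)" and k2: "kills j2 (\<pi> j2)" "\<not> kills j2 (\<pi> j1)"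
      using priv j neq by auto
    have one: "card (killed j1) = 1" "card (killed j2) = 1"
      using lattice_pair_killed(1)[OF L ops[OF j(1)] k1]
        lattice_pair_killed(1)[OF lattice_pair_sym[OF L] ops[OF j(2)] k2] by simp_all
    have sumJ: "sum g J = g j1 + (g j2 + sum g (J - {j1, j2}))" for g :: "nat \<Rightarrow> nat"
    proof -
      have "sum g (insert j1 (insert j2 (J - {j1, j2}))) = g j1 + (g j2 + sum g (J - {j1, j2}))"
        using finJ neq by simp
      moreover have "insert j1 (insert j2 (J - {j1, j2})) = J" using j by blast
      ultimately show ?thesis by (simp only:)
    qed
    show ?thesis
    proof (cases "J = {j1, j2}")
      case True
      \<comment> \<open>Two operations that kill one coordinate each; here the assumption
        \<open>N > 2 \<or> card U > 2\<close> enters.\<close>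
      then have "N \<le> 2" using sum one neq by simp
      then have "card U \<ge> 3" using N by simp
      then have "card J \<le> card U choose 2"
        using choose_two_ge[of "card U"] True neq by simp
      then show ?thesis using J sum_le by blast
    next
      case False
      then obtain j3 where j3: "j3 \<in> J - {j1, j2}" using j by blast
      have two: "card (killed i) + 2 \<le> arity A i" if "i \<in> J - {j1, j2}" for i
      proof (rule lattice_pair_card_killed[OF L])
        have i: "i \<in> J" "i \<noteq> j1" "i \<noteq> j2" using that by blast+
        then show "i \<in> ops" "killed i \<noteq> {}" using ops ne by blast+
        show "\<not> kills i (\<pi> j1)" "\<not> kills i (\<pi> j2)"
          using priv[OF j(1) i(1)] priv[OF j(2) i(1)] i(2,3) by simp_all
      qed
      let ?J = "J - {j2}"
      \<comment> \<open>Every lattice pair contains \<open>\<pi> j2\<close>, so none is left among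
        the private coordinates of \<open>?J\<close>.\<close>
      have "card ?J \<le> card U choose 2"
      proof (rule card_private_ops_le[OF fin, of _ \<pi>])
        fix p q assume pq: "p \<in> ?J" "q \<in> ?J"
        show "\<not> lattice_pair (\<pi> p) (\<pi> q)"
        proof
          assume L': "lattice_pair (\<pi> p) (\<pi> q)"
          have "\<pi> j2 = \<pi> p \<or> \<pi> j2 = \<pi> q"
            by (rule lattice_pair_unique[OF lattice_pair_sym[OF L] ops[OF j(2)] k2 L'])
          then show False using \<pi>_inj[OF j(2), of p] \<pi>_inj[OF j(2), of q] pq by auto
        qed
        show "kills q (\<pi> p) \<longleftrightarrow> q = p" using priv pq by blast
      qed (use finJ \<pi>N in simp_all)
      moreover have "N \<le> (\<Sum>j\<in>?J. arity A j - 1)"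
      proof -
        let ?K = "J - {j1, j2}"
        \<comment> \<open>The strict inequality, due to \<open>j3\<close>, makes up for the one
          coordinate killed by \<open>j2\<close>.\<close>
        have "(\<Sum>j\<in>?K. card (killed j)) < (\<Sum>j\<in>?K. arity A j - 1)"
        proof (rule sum_strict_mono)
          show "card (killed i) < arity A i - 1" if "i \<in> ?K" for i using two[OF that] by simp
        qed (use finJ j3 in auto)
        moreover have "N \<le> 2 + (\<Sum>j\<in>?K. card (killed j))"
          using sum one unfolding sumJ by simp
        moreover have "1 \<le> arity A j1 - 1" using le[OF j(1)] one by simp
        moreover have "(\<Sum>j\<in>?J. arity A j - 1) = (arity A j1 - 1) + (\<Sum>j\<in>?K. arity A j - 1)"
        proof -
          have "?J = insert j1 ?K" using j neq by blast
          moreover have "(\<Sum>j\<in>insert j1 ?K. arity A j - 1) = (arity A j1 - 1) + (\<Sum>j\<in>?K. arity A j - 1)"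
            by (rule sum.insert) (use finJ in auto)
          ultimately show ?thesis by (simp only:)
        qed
        ultimately show ?thesis by linarith
      qed
      moreover have "?J \<subseteq> ops" using J by blast
      ultimately show ?thesis by (intro exI[of _ ?J] conjI)
    qed
  qed
qed

end

text \<open>Without a blocker every coordinate is killed, and \<open>dimension_bound\<close> bounds
  \<open>N\<close> by a sum over at most \<open>r\<close> operations. By \<open>antimono\<close> the
  first \<open>r\<close> operations give at least that sum, but theirs is only
  \<open>N - 1\<close>.\<close>

lemma (in idempotent_alg) elusive_imp_blocker:
  assumes fin: "finite U"
    and antimono: "\<And>i j. 1 \<le> i \<Longrightarrow> i \<le> j \<Longrightarrow> j \<le> num_opers A \<Longrightarrow> arity A j \<le> arity A i"
    and r: "r = min (num_opers A) (card U choose 2)"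
    and N: "N = 1 + (\<Sum>i=1..r. arity A i - 1)" "N > 2 \<or> card U > 2"
    and R: "elusive A N R" "compatible A N R"
  shows "\<exists>C D. cube_term_blocker A C D"
proof (rule ccontr)
  assume none: "\<not> ?thesis"
  obtain C D where CD: "minimal_chipped_cube A N C D"
  proof (rule elusive_imp_minimal_chipped_cube[OF fin R(2,1)])
    fix C D
    assume "\<And>i. i \<in> {1..N} \<Longrightarrow> subuniverse A (D i)" "\<And>i. i \<in> {1..N} \<Longrightarrow> subuniverse A (C i)"
      "\<And>i. i \<in> {1..N} \<Longrightarrow> C i \<noteq> {}" "\<And>i. i \<in> {1..N} \<Longrightarrow> C i \<subset> D i"
      "compatible A N (Pi\<^sub>E {1..N} D - Pi\<^sub>E {1..N} (\<lambda>i. D i - C i))"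
      "\<And>i x c S. i \<in> {1..N} \<Longrightarrow> x \<in> D i - C i \<Longrightarrow> c \<in> C i \<Longrightarrow> subuniverse A S \<Longrightarrow>
           x \<in> S \<Longrightarrow> c \<in> S \<Longrightarrow> D i \<subseteq> S"
    then have "minimal_chipped_cube A N C D"
      by unfold_locales
    then show thesis by (rule that)
  qed
  interpret minimal_chipped_cube A N C D by (rule CD)
  have "\<exists>j\<in>ops. kills j i" if "i \<in> {1..N}" for i
    using blocker_if_not_killed[OF that] none by blast
  from dimension_bound[OF fin N(2) this]
  obtain J where J: "J \<subseteq> ops" "card J \<le> card U choose 2" "N \<le> (\<Sum>j\<in>J. arity A j - 1)"
    by blast
  have "card J \<le> r" using card_mono[OF _ J(1)] J(2) r by simp
  then have "(\<Sum>j\<in>J. arity A j - 1) \<le> (\<Sum>i=1..r. arity A i - 1)"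
    using r antimono by (intro sum_antimono_le[OF J(1)] diff_le_mono) auto
  then show False using J(3) N(1) by simp
qed

theorem theorem20:
  fixes A :: "'a univ_algebra" and r N :: nat
  assumes "is_algebra A"
    and "finite (universe A)"
    and "idempotent_algebra A"
    and "\<And>i j. 1 \<le> i \<Longrightarrow> i \<le> j \<Longrightarrow> j \<le> num_opers A \<Longrightarrow> arity A j \<le> arity A i"
    and "r = min (num_opers A) (card (universe A) choose 2)"
    and "N = 1 + (\<Sum>i=1..r. arity A i - 1)"
    and "N > 2 \<or> card (universe A) > 2"
  shows "((\<not> (\<exists>d. has_cube_term A d)) \<longleftrightarrow> (\<exists>C D. cube_term_blocker A C D)) \<and>
         ((\<exists>C D. cube_term_blocker A C D) \<longleftrightarrow> \<not> has_cube_term A N) \<and>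
         (\<not> has_cube_term A N \<longleftrightarrow> (\<exists>R. elusive A N R \<and> compatible A N R)) \<and>
         ((\<exists>R. elusive A N R \<and> compatible A N R) \<longleftrightarrow>
            (\<exists>R. chipped_cube A N R \<and> compatible A N R))"
proof -
  interpret idempotent_alg A by unfold_locales fact+
  have N: "N \<ge> 1" using assms(6) by simp
  \<comment> \<open>The implications run from (d) to (b), (a), (c) and back to (d), and from (b)
    through (e) to (d).\<close>
  have d_b: "\<exists>C D. cube_term_blocker A C D" if "\<exists>R. elusive A N R \<and> compatible A N R"
    using that elusive_imp_blocker[OF assms(2,4-7)] by blast
  have b_a: "\<not> has_cube_term A d" if "\<exists>C D. cube_term_blocker A C D" for d
  proof (cases "d \<ge> 1")
    case True
    then show ?thesis
      using that blocker_chipped_cube chipped_cube_elusive elusive_no_cube_term by metis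
  \<comment> \<open>Dimension 0 is ruled out by the definition of
    \<open>has_cube_term\<close>.\<close>
  qed (simp add: has_cube_term_def)
  have b_e: "\<exists>R. chipped_cube A N R \<and> compatible A N R" if "\<exists>C D. cube_term_blocker A C D"
    using that blocker_chipped_cube[OF _ N] by metis
  have e_d: "\<exists>R. elusive A N R \<and> compatible A N R" if "\<exists>R. chipped_cube A N R \<and> compatible A N R"
    using that chipped_cube_elusive by metis
  have c_d: "\<exists>R. elusive A N R \<and> compatible A N R" if "\<not> has_cube_term A N"
    using cube_term_if_no_elusive[OF assms(2) N] that by metis
  show ?thesis
    using d_b b_a b_e e_d c_d by metis
qed

end
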